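(* Let $n$ be a non-negative integer, let $X$ be a separable metric space and let $\mathcal{F}$ be an open cover of $X$ that is weakly regular for the class of at most $n$-dimensional separable metric spaces. Then each canonical map $\varkappa \colon X \to N(\mathcal{F})$ into the nerve of $\mathcal{F}$ induces isomorphisms on homotopy groups of dimensions less than $n$.
   Context: Maps are continuous. A space $Z$ is an absolute extensor for a space $W$ if each map from a closed subset of $W$ into $Z$ extends over all of $W$; $AE(\mathcal{C})$ denotes the class of absolute extensors for all spaces from a class $\mathcal{C}$. A cover is a weak $AE(\mathcal{C})$-cover if the union of each (non-empty) collection of its elements that has a non-empty intersection belongs to $AE(\mathcal{C})$. An open cover is weakly regular for $\mathcal{C}$ if it is a locally finite weak $AE(\mathcal{C})$-cover. The nerve $N(\mathcal{F})$ is the simplicial complex with vertices $v(F)$ corresponding to the non-empty elements $F$ of $\mathcal{F}$, in which a finite set of vertices spans a simplex if and only if the corresponding elements of $\mathcal{F}$ have non-empty intersection; simplicial complexes are taken with the metric topology. A canonical map into the nerve is a map induced by a partition of unity $\{\varphi_F\}_{F\in\mathcal{F}}$ subordinated to $\mathcal{F}$ (with $\varphi_F$ vanishing outside $F$), by interpreting its values at a point $x$ as barycentric coordinates of the point $\varkappa(x)$ of $N(\mathcal{F})$. Dimension is covering dimension. Isomorphism on homotopy groups in dimension $0$ means a bijection of sets of path components; in positive dimensions it is meant at all base points. *)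

theory Defs
  imports "HOL-Analysis.Analysis" "HOL-Algebra.Group"
begin

section \<open>Covering dimension and absolute extensors\<close>

text \<open>\<open>dim W \<le> n\<close>: every finite open cover has a finite open refinement of order at most
  \<open>n\<close>, i.e. no point lies in more than \<open>n + 1\<close> members of the refinement.\<close>

definition covering_dim_le :: "'w topology \<Rightarrow> nat \<Rightarrow> bool" where
  "covering_dim_le W n \<longleftrightarrow>
     (\<forall>\<U>. finite \<U> \<and> (\<forall>U\<in>\<U>. openin W U) \<and> \<Union>\<U> = topspace W \<longrightarrow>
       (\<exists>\<V>. finite \<V> \<and> (\<forall>V\<in>\<V>. openin W V) \<and> \<Union>\<V> = topspace W \<and>
            (\<forall>V\<in>\<V>. \<exists>U\<in>\<U>. V \<subseteq> U) \<and>
            (\<forall>x\<in>topspace W. card {V\<in>\<V>. x \<in> V} \<le> n + 1)))"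

definition absolute_extensor_for :: "'z topology \<Rightarrow> 'w topology \<Rightarrow> bool" where
  "absolute_extensor_for Z W \<longleftrightarrow>
     (\<forall>A f. closedin W A \<and> continuous_map (subtopology W A) Z f \<longrightarrow>
        (\<exists>g. continuous_map W Z g \<and> (\<forall>x\<in>A. g x = f x)))"

definition absolute_extensors :: "('w topology \<Rightarrow> bool) \<Rightarrow> 'z topology \<Rightarrow> bool" where
  "absolute_extensors \<C> Z \<longleftrightarrow> (\<forall>W. \<C> W \<longrightarrow> absolute_extensor_for Z W)"

definition separable_metric_dim_le :: "nat \<Rightarrow> 'w topology \<Rightarrow> bool" where
  "separable_metric_dim_le n W \<longleftrightarrow>
     metrizable_space W \<and> separable_space W \<and> covering_dim_le W n"

text \<open>A class of spaces is a predicate on the topologies over one fixed type.  For separable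
  metric spaces the type \<^typ>\<open>real\<close> is large enough, since such a space has at most continuum many
  points; \<open>absolute_extensors_universal\<close> below shows that testing against the spaces
  with points in \<^typ>\<open>real\<close> is the same as testing against those with points in any type.\<close>

abbreviation separable_metric_spaces_dim_le :: "nat \<Rightarrow> real topology \<Rightarrow> bool" where
  "separable_metric_spaces_dim_le n \<equiv> separable_metric_dim_le n"


section \<open>Weakly regular covers\<close>

definition weak_AE_cover :: "('w topology \<Rightarrow> bool) \<Rightarrow> 'a topology \<Rightarrow> 'a set set \<Rightarrow> bool" where
  "weak_AE_cover \<C> X \<F> \<longleftrightarrow> \<Union>\<F> = topspace X \<and>
     (\<forall>\<G>\<subseteq>\<F>. \<G> \<noteq> {} \<and> \<Inter>\<G> \<noteq> {} \<longrightarrow> absolute_extensors \<C> (subtopology X (\<Union>\<G>)))"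

definition weakly_regular_cover ::
    "('w topology \<Rightarrow> bool) \<Rightarrow> 'a topology \<Rightarrow> 'a set set \<Rightarrow> bool" where
  "weakly_regular_cover \<C> X \<F> \<longleftrightarrow>
     (\<forall>F\<in>\<F>. openin X F) \<and> locally_finite_in X \<F> \<and> weak_AE_cover \<C> X \<F>"


section \<open>Nerves and canonical maps\<close>

text \<open>An abstract simplicial complex is given by its set of simplices (finite non-empty vertex
  sets).  The points of its realization are the families of barycentric coordinates.\<close>

definition realization :: "'v set set \<Rightarrow> ('v \<Rightarrow> real) set" where
  "realization K = {b. (\<forall>v. 0 \<le> b v) \<and> {v. b v \<noteq> 0} \<in> K \<and> (\<Sum>v | b v \<noteq> 0. b v) = 1}"

definition bary_dist :: "('v \<Rightarrow> real) \<Rightarrow> ('v \<Rightarrow> real) \<Rightarrow> real" where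
  "bary_dist b c = (\<Sum>v | b v \<noteq> 0 \<or> c v \<noteq> 0. \<bar>b v - c v\<bar>)"

definition metric_realization :: "'v set set \<Rightarrow> ('v \<Rightarrow> real) topology" where
  "metric_realization K = Metric_space.mtopology (realization K) bary_dist"

text \<open>The empty set is not a vertex: \<open>\<Inter>\<sigma> \<noteq> {}\<close> forces all members of \<open>\<sigma>\<close> to be non-empty.\<close>

definition nerve :: "'a set set \<Rightarrow> 'a set set set" where
  "nerve \<F> = {\<sigma>. \<sigma> \<subseteq> \<F> \<and> finite \<sigma> \<and> \<sigma> \<noteq> {} \<and> \<Inter>\<sigma> \<noteq> {}}"

text \<open>The condition that the sum be \<open>1\<close> includes that only finitely many \<open>\<phi> F x\<close> are non-zero,
  because \<open>sum\<close> over an infinite set is \<open>0\<close>; for a locally finite \<open>\<F>\<close> this is automatic.\<close>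

definition partition_of_unity_subordinated ::
    "'a topology \<Rightarrow> 'a set set \<Rightarrow> ('a set \<Rightarrow> 'a \<Rightarrow> real) \<Rightarrow> bool" where
  "partition_of_unity_subordinated X \<F> \<phi> \<longleftrightarrow>
     (\<forall>F\<in>\<F>. continuous_map X euclideanreal (\<phi> F) \<and>
        (\<forall>x\<in>topspace X. 0 \<le> \<phi> F x) \<and> (\<forall>x\<in>topspace X - F. \<phi> F x = 0)) \<and>
     (\<forall>x\<in>topspace X. (\<Sum>F | F \<in> \<F> \<and> \<phi> F x \<noteq> 0. \<phi> F x) = 1)"

definition canonical_map ::
    "'a topology \<Rightarrow> 'a set set \<Rightarrow> ('a \<Rightarrow> 'a set \<Rightarrow> real) \<Rightarrow> bool" where
  "canonical_map X \<F> \<kappa> \<longleftrightarrow>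
     (\<exists>\<phi>. partition_of_unity_subordinated X \<F> \<phi> \<and>
        (\<forall>x\<in>topspace X. \<kappa> x = (\<lambda>F. if F \<in> \<F> then \<phi> F x else 0)))"


section \<open>Homotopy groups\<close>

definition cube :: "nat \<Rightarrow> (nat \<Rightarrow> real) topology" where
  "cube k = product_topology (\<lambda>_. top_of_set {0..1}) {..<k}"

definition cube_boundary :: "nat \<Rightarrow> (nat \<Rightarrow> real) set" where
  "cube_boundary k = {t \<in> topspace (cube k). \<exists>i<k. t i = 0 \<or> t i = 1}"

definition spheroids :: "nat \<Rightarrow> 'a topology \<Rightarrow> 'a \<Rightarrow> ((nat \<Rightarrow> real) \<Rightarrow> 'a) set" where
  "spheroids k X a = {f. continuous_map (cube k) X f \<and> (\<forall>t\<in>cube_boundary k. f t = a)}"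

text \<open>The class of \<open>f\<close> modulo homotopy relative to the boundary of the cube.  Values outside the
  cube are irrelevant: maps that agree on the cube are identified.\<close>

definition spheroid_class ::
    "nat \<Rightarrow> 'a topology \<Rightarrow> 'a \<Rightarrow> ((nat \<Rightarrow> real) \<Rightarrow> 'a) \<Rightarrow> ((nat \<Rightarrow> real) \<Rightarrow> 'a) set" where
  "spheroid_class k X a f =
     {g. homotopic_with (\<lambda>h. \<forall>t\<in>cube_boundary k. h t = a) (cube k) X f g}"

definition spheroid_join ::
    "((nat \<Rightarrow> real) \<Rightarrow> 'a) \<Rightarrow> ((nat \<Rightarrow> real) \<Rightarrow> 'a) \<Rightarrow> (nat \<Rightarrow> real) \<Rightarrow> 'a" where
  "spheroid_join f g t =
     (if t 0 \<le> 1/2 then f (t(0 := 2 * t 0)) else g (t(0 := 2 * t 0 - 1)))"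

text \<open>For \<open>k \<ge> 1\<close> only.  The union in the product is over equal sets, as in the library's treatment
  of functions on equivalence classes.\<close>

definition homotopy_group ::
    "nat \<Rightarrow> 'a topology \<Rightarrow> 'a \<Rightarrow> ((nat \<Rightarrow> real) \<Rightarrow> 'a) set monoid" where
  "homotopy_group k X a =
     \<lparr>carrier = spheroid_class k X a ` spheroids k X a,
      mult = (\<lambda>A B. \<Union>f\<in>A. \<Union>g\<in>B. spheroid_class k X a (spheroid_join f g)),
      one = spheroid_class k X a (\<lambda>_. a)\<rparr>"

definition homotopy_group_map ::
    "nat \<Rightarrow> 'b topology \<Rightarrow> ('a \<Rightarrow> 'b) \<Rightarrow> 'a
      \<Rightarrow> ((nat \<Rightarrow> real) \<Rightarrow> 'a) set \<Rightarrow> ((nat \<Rightarrow> real) \<Rightarrow> 'b) set" where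
  "homotopy_group_map k Y p a A = (\<Union>f\<in>A. spheroid_class k Y (p a) (p \<circ> f))"

definition path_components_map :: "'b topology \<Rightarrow> ('a \<Rightarrow> 'b) \<Rightarrow> 'a set \<Rightarrow> 'b set" where
  "path_components_map Y p C = (\<Union>x\<in>C. path_component_of_set Y (p x))"

text \<open>Continuity is included since only a continuous map induces maps on homotopy groups.\<close>

definition induces_homotopy_isos_below ::
    "nat \<Rightarrow> 'a topology \<Rightarrow> 'b topology \<Rightarrow> ('a \<Rightarrow> 'b) \<Rightarrow> bool" where
  "induces_homotopy_isos_below n X Y p \<longleftrightarrow>
     continuous_map X Y p \<and>
     (\<forall>k<n. if k = 0
        then bij_betw (path_components_map Y p) (path_components_of X) (path_components_of Y)
        else (\<forall>a\<in>topspace X.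
                homotopy_group_map k Y p a \<in> iso (homotopy_group k X a) (homotopy_group k Y (p a))))"


section \<open>Auxiliary facts about the definitions\<close>

lemma finite_support_realization:
  assumes "b \<in> realization K"
  shows "finite {v. b v \<noteq> 0}"
  using assms sum.infinite by (fastforce simp: realization_def)

lemma bary_dist_superset:
  assumes "finite S" "{v. b v \<noteq> 0} \<subseteq> S" "{v. c v \<noteq> 0} \<subseteq> S"
  shows "bary_dist b c = (\<Sum>v\<in>S. \<bar>b v - c v\<bar>)"
  unfolding bary_dist_def by (rule sum.mono_neutral_left) (use assms in auto)

lemma Metric_space_realization: "Metric_space (realization K) bary_dist"
proof
  show "0 \<le> bary_dist b c" for b c :: "'a \<Rightarrow> real"
    by (simp add: bary_dist_def sum_nonneg)
  show "bary_dist b c = bary_dist c b" for b c :: "'a \<Rightarrow> real"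
    unfolding bary_dist_def by (rule sum.cong) auto
next
  fix b c assume b: "b \<in> realization K" and c: "c \<in> realization K"
  define S where "S = {v. b v \<noteq> 0} \<union> {v. c v \<noteq> 0}"
  have fin: "finite S"
    using b c by (simp add: S_def finite_support_realization)
  have eq: "bary_dist b c = (\<Sum>v\<in>S. \<bar>b v - c v\<bar>)"
    by (rule bary_dist_superset) (use fin in \<open>auto simp: S_def\<close>)
  show "bary_dist b c = 0 \<longleftrightarrow> b = c"
  proof
    assume "bary_dist b c = 0"
    then have "\<forall>v\<in>S. \<bar>b v - c v\<bar> = 0"
      using eq fin by (simp add: sum_nonneg_eq_0_iff)
    moreover have "b v = c v" if "v \<notin> S" for v
      using that by (simp add: S_def)
    ultimately show "b = c"
      by (metis abs_eq_0 eq_iff_diff_eq_0 ext)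
  qed (simp add: bary_dist_def)
next
  fix b c d assume *: "b \<in> realization K" "c \<in> realization K" "d \<in> realization K"
  define S where "S = {v. b v \<noteq> 0} \<union> {v. c v \<noteq> 0} \<union> {v. d v \<noteq> 0}"
  have fin: "finite S"
    using * by (simp add: S_def finite_support_realization)
  have sub: "{v. b v \<noteq> 0} \<subseteq> S" "{v. c v \<noteq> 0} \<subseteq> S" "{v. d v \<noteq> 0} \<subseteq> S"
    by (auto simp: S_def)
  have "bary_dist b d = (\<Sum>v\<in>S. \<bar>b v - d v\<bar>)"
    by (rule bary_dist_superset[OF fin sub(1,3)])
  also have "\<dots> \<le> (\<Sum>v\<in>S. \<bar>b v - c v\<bar> + \<bar>c v - d v\<bar>)"
    by (rule sum_mono) linarith
  also have "\<dots> = bary_dist b c + bary_dist c d"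
    by (simp only: sum.distrib bary_dist_superset[OF fin sub(1,2)] bary_dist_superset[OF fin sub(2,3)])
  finally show "bary_dist b d \<le> bary_dist b c + bary_dist c d" .
qed

lemma absolute_extensor_for_homeomorphic:
  assumes hom: "homeomorphic_maps W W' p q" and Z: "absolute_extensor_for Z W'"
  shows "absolute_extensor_for Z W"
  unfolding absolute_extensor_for_def
proof (intro allI impI, elim conjE)
  fix A f assume A: "closedin W A" and f: "continuous_map (subtopology W A) Z f"
  have p: "continuous_map W W' p" and q: "continuous_map W' W q"
    and qp: "\<And>x. x \<in> topspace W \<Longrightarrow> q (p x) = x"
    using hom by (auto simp: homeomorphic_maps_def)
  have AW: "A \<subseteq> topspace W"
    using A closedin_subset by auto
  have "homeomorphic_map W W' p"
    using hom homeomorphic_maps_map by blast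
  then have cl: "closedin W' (p ` A)"
    using A AW homeomorphic_map_closedness by blast
  have "continuous_map (subtopology W' (p ` A)) (subtopology W A) q"
    using q qp AW
    by (auto simp: continuous_map_in_subtopology continuous_map_from_subtopology subset_iff)
  then have "continuous_map (subtopology W' (p ` A)) Z (f \<circ> q)"
    using f continuous_map_compose by blast
  then obtain g where g: "continuous_map W' Z g" "\<forall>x\<in>p ` A. g x = (f \<circ> q) x"
    using Z cl unfolding absolute_extensor_for_def by blast
  have "continuous_map W Z (g \<circ> p)"
    using p g(1) continuous_map_compose by blast
  moreover have "\<forall>x\<in>A. (g \<circ> p) x = f x"
    using g(2) qp AW by auto
  ultimately show "\<exists>g. continuous_map W Z g \<and> (\<forall>x\<in>A. g x = f x)"
    by blast
qed

lemma covering_dim_le_homeomorphic: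
  assumes hom: "homeomorphic_maps W W' p q" and dim: "covering_dim_le W n"
  shows "covering_dim_le W' n"
  unfolding covering_dim_le_def
proof (intro allI impI, elim conjE)
  fix \<U> assume \<U>: "finite \<U>" "\<forall>U\<in>\<U>. openin W' U" "\<Union>\<U> = topspace W'"
  have hp: "homeomorphic_map W W' p" and hq: "homeomorphic_map W' W q"
    using hom homeomorphic_maps_map by blast+
  have pq: "\<And>y. y \<in> topspace W' \<Longrightarrow> p (q y) = y" and qp: "\<And>x. x \<in> topspace W \<Longrightarrow> q (p x) = x"
    using hom by (auto simp: homeomorphic_maps_def)
  have imq: "q ` topspace W' = topspace W" and imp: "p ` topspace W = topspace W'"
    using hp hq homeomorphic_imp_surjective_map by blast+
  have "finite ((`) q ` \<U>)" "\<forall>U\<in>(`) q ` \<U>. openin W U" "\<Union>((`) q ` \<U>) = topspace W"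
  proof -
    show "finite ((`) q ` \<U>)" using \<U>(1) by simp
    show "\<forall>U\<in>(`) q ` \<U>. openin W U"
      using \<U>(2) homeomorphic_map_openness_eq[OF hq] by auto
    show "\<Union>((`) q ` \<U>) = topspace W"
      by (simp only: image_Union[symmetric] \<U>(3) imq)
  qed
  then obtain \<V> where \<V>: "finite \<V>" "\<forall>V\<in>\<V>. openin W V" "\<Union>\<V> = topspace W"
      "\<forall>V\<in>\<V>. \<exists>U\<in>(`) q ` \<U>. V \<subseteq> U" "\<forall>x\<in>topspace W. card {V\<in>\<V>. x \<in> V} \<le> n + 1"
    using dim[unfolded covering_dim_le_def, THEN spec, of "(`) q ` \<U>"] by (elim impE exE conjE) simp_all
  have VW: "V \<subseteq> topspace W" if "V \<in> \<V>" for V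
    using that \<V>(3) by blast
  have "\<forall>V\<in>(`) p ` \<V>. openin W' V"
    using \<V>(2) homeomorphic_map_openness_eq[OF hp] by auto
  moreover have "\<Union>((`) p ` \<V>) = topspace W'"
    by (simp only: image_Union[symmetric] \<V>(3) imp)
  moreover have "\<forall>V\<in>(`) p ` \<V>. \<exists>U\<in>\<U>. V \<subseteq> U"
  proof
    fix V' assume "V' \<in> (`) p ` \<V>"
    then obtain V U where V: "V \<in> \<V>" "V' = p ` V" and U: "U \<in> \<U>" "V \<subseteq> q ` U"
      using \<V>(4) by blast
    have "V' \<subseteq> p ` q ` U"
      using V U by blast
    also have "\<dots> = U"
    proof -
      have "p (q y) = y" if "y \<in> U" for y
        using that U(1) \<U>(3) by (intro pq) blast
      then show ?thesis
        by (simp add: image_image)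
    qed
    finally show "\<exists>U\<in>\<U>. V' \<subseteq> U"
      using U(1) by blast
  qed
  moreover have "\<forall>y\<in>topspace W'. card {V\<in>(`) p ` \<V>. y \<in> V} \<le> n + 1"
  proof
    fix y assume y: "y \<in> topspace W'"
    have sub: "{V\<in>(`) p ` \<V>. y \<in> V} \<subseteq> (`) p ` {V\<in>\<V>. q y \<in> V}"
    proof
      fix V' assume "V' \<in> {V\<in>(`) p ` \<V>. y \<in> V}"
      then obtain V x where V: "V \<in> \<V>" "V' = p ` V" and x: "x \<in> V" "y = p x"
        by blast
      then have "q y = x"
        using qp VW by blast
      then show "V' \<in> (`) p ` {V\<in>\<V>. q y \<in> V}"
        using V x by simp
    qed
    have "card {V\<in>(`) p ` \<V>. y \<in> V} \<le> card {V\<in>\<V>. q y \<in> V}"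
      by (rule surj_card_le[OF _ sub]) (simp add: \<V>(1))
    also have "\<dots> \<le> n + 1"
      using \<V>(5) y imq by blast
    finally show "card {V\<in>(`) p ` \<V>. y \<in> V} \<le> n + 1" .
  qed
  ultimately show "\<exists>\<V>. finite \<V> \<and> (\<forall>V\<in>\<V>. openin W' V) \<and> \<Union>\<V> = topspace W' \<and>
      (\<forall>V\<in>\<V>. \<exists>U\<in>\<U>. V \<subseteq> U) \<and> (\<forall>x\<in>topspace W'. card {V\<in>\<V>. x \<in> V} \<le> n + 1)"
    using finite_imageI[OF \<V>(1), of "(`) p"] by blast
qed

lemma separable_metrizable_inj_real:
  fixes W :: "'w topology"
  assumes "metrizable_space W" "separable_space W"
  obtains j :: "'w \<Rightarrow> real" where "inj_on j (topspace W)"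
proof -
  obtain M d where "Metric_space M d" and W: "W = Metric_space.mtopology M d"
    using assms(1) by (auto simp: metrizable_space_def)
  then interpret Metric_space M d by simp
  obtain C where C: "countable C" "C \<subseteq> M" and dense: "Abstract_Topology.closure_of mtopology C = M"
    using assms(2) by (auto simp: separable_space_def W)
  define s :: "'w \<Rightarrow> nat set" where
    "s x = {prod_encode (to_nat_on C c, k) | c k. c \<in> C \<and> d c x < inverse (real (Suc k))}" for x
  have "inj_on s M"
  proof (rule inj_onI, rule ccontr)
    fix x y assume xy: "x \<in> M" "y \<in> M" "s x = s y" "x \<noteq> y"
    then have "0 < d x y / 2" by simp
    then obtain k where k: "inverse (real (Suc k)) < d x y / 2"
      using reals_Archimedean by blast
    have "x \<in> Abstract_Topology.closure_of mtopology C"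
      using dense xy(1) by simp
    then obtain c where c: "c \<in> C" "d x c < inverse (real (Suc k))"
      unfolding metric_closure_of mem_Collect_eq using inverse_positive_iff_positive[of "real (Suc k)"]
      by (metis in_mball of_nat_0_less_iff zero_less_Suc)
    then have "prod_encode (to_nat_on C c, k) \<in> s x"
      by (auto simp: s_def commute)
    then have "prod_encode (to_nat_on C c, k) \<in> s y"
      using xy(3) by simp
    then obtain c' where c': "c' \<in> C" "to_nat_on C c' = to_nat_on C c"
        "d c' y < inverse (real (Suc k))"
      by (auto simp: s_def prod_encode_eq)
    then have "c' = c"
      using C(1) c(1) by (simp add: to_nat_on_inj)
    moreover have "d x y \<le> d x c + d c y"
      using triangle xy C(2) c(1) by blast
    ultimately show False
      using c(2) c'(3) k by simp
  qed
  moreover obtain i :: "nat set \<Rightarrow> real" where "inj i"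
    using eqpoll_imp_lepoll[OF nat_sets_eqpoll_reals] by (auto simp: lepoll_def)
  ultimately have "inj_on (i \<circ> s) M"
    by (meson comp_inj_on inj_on_subset subset_UNIV)
  then show ?thesis
    using that by (simp add: W)
qed

lemma absolute_extensors_universal:
  fixes W :: "'w topology"
  assumes Z: "absolute_extensors (separable_metric_spaces_dim_le n) Z" and W: "separable_metric_dim_le n W"
  shows "absolute_extensor_for Z W"
proof -
  obtain j :: "'w \<Rightarrow> real" where j: "inj_on j (topspace W)"
    using W separable_metrizable_inj_real by (auto simp: separable_metric_dim_le_def)
  define q where "q = inv_into (topspace W) j"
  define W' where "W' = pullback_topology (j ` topspace W) q W"
  have qj: "q (j x) = x" if "x \<in> topspace W" for x
    using that j by (simp add: q_def)
  have top': "topspace W' = j ` topspace W"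
    by (auto simp: W'_def topspace_pullback_topology qj)
  have "continuous_map W' W q"
    using continuous_map_pullback[OF continuous_map_id, where f = q and A = "j ` topspace W"]
    by (simp add: W'_def id_def comp_def)
  moreover have "continuous_map W W' j"
    unfolding W'_def
  proof (rule continuous_map_pullback')
    show "continuous_map W W (q \<circ> j)"
      by (rule continuous_map_eq[OF continuous_map_id]) (simp add: qj)
  qed auto
  ultimately have hom: "homeomorphic_maps W W' j q"
    by (auto simp: homeomorphic_maps_def top' qj)
  then have "W homeomorphic_space W'"
    by (auto simp: homeomorphic_space_def)
  then have "separable_metric_spaces_dim_le n W'"
    using W covering_dim_le_homeomorphic[OF hom]
      homeomorphic_metrizable_space[of W W'] homeomorphic_separable_space[of W W']
    by (auto simp: separable_metric_dim_le_def)
  then show ?thesis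
    using Z absolute_extensor_for_homeomorphic[OF hom] by (auto simp: absolute_extensors_def)
qed

end

theory Submission
  imports Defs
begin

text \<open>The heart of the matter is a relative lifting property: if \<open>W\<close> is a compact separable metric
  space of dimension at most \<open>n\<close>, \<open>A\<close> is closed in \<open>W\<close>, and \<open>h\<close> maps \<open>W\<close> into the nerve so that
  \<open>h = \<kappa> \<circ> f\<close> on \<open>A\<close>, then \<open>f\<close> extends to a map \<open>g\<close> from \<open>W\<close> to \<open>X\<close> with \<open>\<kappa> \<circ> g\<close> homotopic to \<open>h\<close>
  relative to \<open>A\<close> (\<open>relative_homotopy_lifting\<close>).  For \<open>k < n\<close> this applied to the \<open>k\<close>-cube
  and its boundary gives surjectivity on the \<open>k\<close>-th homotopy group, and applied to the cylinder
  over the \<open>k\<close>-cube, of dimension \<open>k + 1 \<le> n\<close>, it gives injectivity; the unit interval does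
  the same for path components.

  To lift \<open>h\<close>, pull back the open stars of the vertices of the nerve.  At a point \<open>w\<close> the members
  \<open>F\<close> of the cover with \<open>h w F \<noteq> 0\<close> span a simplex, so their union, and the union of any non-empty subset
  of them, is an absolute extensor.  Finitely many of the open sets cover \<open>W\<close>, and \<open>g\<close> with \<open>g w\<close>
  in \<open>\<Union>{F. h w F \<noteq> 0}\<close> is constructed stratum by stratum
  (\<open>extension_subordinate_to_cover\<close>).  Then some \<open>F\<close> that contains \<open>g w\<close> is a vertex of the
  support of \<open>h w\<close>, and any finitely many members of the cover that contain \<open>g w\<close> span a simplex.  Within such a simplex the point
  \<open>\<kappa> (g w)\<close> can be moved to the carrier of \<open>h w\<close> and from there to \<open>h w\<close>, both linearly
  (\<open>homotopic_with_meeting_supports\<close>); the intermediate point is chosen so that nothing moves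
  where \<open>\<kappa> (g w) = h w\<close>.

  That cubes and cylinders belong to the test class is Lebesgue's estimate for the covering
  dimension (\<open>separable_metric_dim_le_coordinates\<close>).\<close>

section \<open>Maps into a metric realization\<close>

lemma sum_realization:
  assumes "b \<in> realization K" "finite T" "{v. b v \<noteq> 0} \<subseteq> T"
  shows "sum b T = 1"
proof -
  have "sum b {v. b v \<noteq> 0} = sum b T"
    by (rule sum.mono_neutral_left) (use assms in auto)
  with assms(1) show ?thesis
    by (simp add: realization_def)
qed

text \<open>The topology of \<open>metric_realization\<close> is that of pointwise convergence of barycentric
  coordinates.  The reason is Scheffe's argument: near a point \<open>b\<close> almost all mass of a nearby point
  sits on the finite support of \<open>b\<close>, and since the total mass is always \<open>1\<close>, little is left
  elsewhere.\<close>

lemma continuous_map_metric_realization: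
  "continuous_map W (metric_realization K) b \<longleftrightarrow>
     (\<forall>w\<in>topspace W. b w \<in> realization K) \<and> (\<forall>v. continuous_map W euclideanreal (\<lambda>w. b w v))"
  (is "?L \<longleftrightarrow> ?R")
proof -
  interpret R: Metric_space "realization K" bary_dist
    by (rule Metric_space_realization)
  have N: "metric_realization K = R.mtopology"
    by (simp add: metric_realization_def)
  show ?thesis
  proof
    assume L: ?L
    have "continuous_map (metric_realization K) euclideanreal (\<lambda>c. c v)" for v
      unfolding N mtopology_is_euclidean[symmetric]
        R.metric_continuous_map[OF Met_TC.Metric_space_axioms]
    proof (intro conjI ballI allI impI)
      fix a and \<epsilon> :: real
      assume a: "a \<in> realization K" and "\<epsilon> > 0"
      have "dist (a v) (x v) \<le> bary_dist a x" if "x \<in> realization K" for x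
      proof -
        have fin: "finite (insert v ({v. a v \<noteq> 0} \<union> {v. x v \<noteq> 0}))"
          using a that by (simp add: finite_support_realization)
        have "bary_dist a x = (\<Sum>v\<in>insert v ({v. a v \<noteq> 0} \<union> {v. x v \<noteq> 0}). \<bar>a v - x v\<bar>)"
          by (rule bary_dist_superset[OF fin]) auto
        then show ?thesis
          using member_le_sum[OF insertI1 _ fin, of "\<lambda>v. \<bar>a v - x v\<bar>"] by (simp add: dist_real_def)
      qed
      then show "\<exists>\<delta>>0. \<forall>x. x \<in> realization K \<and> bary_dist a x < \<delta> \<longrightarrow> dist (a v) (x v) < \<epsilon>"
        using \<open>\<epsilon> > 0\<close> by (meson order_le_less_trans)
    qed auto
    from continuous_map_compose[OF L this] have "continuous_map W euclideanreal (\<lambda>w. b w v)" for v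
      by (simp add: o_def)
    moreover have "b w \<in> realization K" if "w \<in> topspace W" for w
      using L that by (auto simp: N continuous_map_def)
    ultimately show ?R
      by blast
  next
    assume R: ?R
    show ?L
      unfolding N R.continuous_map_to_metric
    proof (intro ballI allI impI)
      fix w and \<epsilon> :: real
      assume w: "w \<in> topspace W" and "\<epsilon> > 0"
      define S where "S = {v. b w v \<noteq> 0}"
      define q where "q y = (\<Sum>v\<in>S. \<bar>b y v - b w v\<bar>)" for y
      have bw: "b w \<in> realization K"
        using R w by blast
      then have finS: "finite S"
        by (simp add: S_def finite_support_realization)
      have "continuous_map W euclideanreal q"
        unfolding q_def using R finS by (intro continuous_intros) auto
      then have "openin W {y \<in> topspace W. q y \<in> {..<\<epsilon>/2}}"
        by (rule openin_continuous_map_preimage) auto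
      moreover have "q w = 0"
        by (simp add: q_def)
      moreover have "bary_dist (b w) (b y) < \<epsilon>" if "y \<in> topspace W" "q y < \<epsilon>/2" for y
      proof -
        have ry: "b y \<in> realization K"
          using R that by blast
        define S' where "S' = {v. b y v \<noteq> 0} - S"
        have fin: "finite S'" "finite (S \<union> S')"
          using ry finS by (auto simp: S'_def finite_support_realization)
        have dis: "S \<inter> S' = {}"
          by (auto simp: S'_def)
        have "sum (b y) (S \<union> S') = 1" "sum (b w) S = 1"
          using ry bw finS fin by (auto intro!: sum_realization simp: S'_def S_def)
        then have "sum (b y) S' = (\<Sum>v\<in>S. b w v - b y v)"
          using finS fin dis by (simp add: sum.union_disjoint sum_subtractf)
        also have "\<dots> \<le> q y"
          unfolding q_def by (rule sum_mono) auto
        finally have "sum (b y) S' \<le> q y" .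
        moreover have "(\<Sum>v\<in>S'. \<bar>b w v - b y v\<bar>) = sum (b y) S'"
          using ry by (intro sum.cong) (auto simp: S'_def S_def realization_def)
        moreover have "bary_dist (b w) (b y) = (\<Sum>v\<in>S \<union> S'. \<bar>b w v - b y v\<bar>)"
          by (rule bary_dist_superset[OF fin(2)]) (auto simp: S'_def S_def)
        moreover have "(\<Sum>v\<in>S. \<bar>b w v - b y v\<bar>) = q y"
          unfolding q_def by (intro sum.cong) (auto simp: abs_minus_commute)
        ultimately have "bary_dist (b w) (b y) \<le> q y + q y"
          using finS fin dis by (simp add: sum.union_disjoint)
        then show ?thesis
          using that by simp
      qed
      ultimately show "\<exists>U. openin W U \<and> w \<in> U \<and> (\<forall>y\<in>U. b y \<in> R.mball (b w) \<epsilon>)"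
        using R w \<open>\<epsilon> > 0\<close> by (intro exI[of _ "{y \<in> topspace W. q y \<in> {..<\<epsilon>/2}}"]) auto
    qed
  qed
qed

lemma continuous_map_bary_dist:
  assumes "continuous_map W (metric_realization K) b" "continuous_map W (metric_realization K) c"
  shows "continuous_map W euclideanreal (\<lambda>w. bary_dist (b w) (c w))"
proof -
  interpret R: Metric_space "realization K" bary_dist
    by (rule Metric_space_realization)
  show ?thesis
    using continuous_map_mdist[of W R.Self b c] assms by (simp add: metric_realization_def mtopology_of_def)
qed

lemma homotopic_with_linear_realization:
  assumes b: "continuous_map W (metric_realization K) b"
    and c: "continuous_map W (metric_realization K) c"
    and K: "\<And>w. w \<in> topspace W \<Longrightarrow> {v. b w v \<noteq> 0} \<union> {v. c w v \<noteq> 0} \<in> K"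
    and A: "\<And>a. a \<in> A \<Longrightarrow> b a = r a" "\<And>a. a \<in> A \<Longrightarrow> c a = r a"
  shows "homotopic_with (\<lambda>k. \<forall>a\<in>A. k a = r a) W (metric_realization K) b c"
  unfolding homotopic_with_def
proof (intro exI conjI)
  let ?H = "\<lambda>(t::real, w). (\<lambda>v. (1 - t) * b w v + t * c w v)"
  show "continuous_map (prod_topology (top_of_set {0..1}) W) (metric_realization K) ?H"
    unfolding continuous_map_metric_realization
  proof (intro conjI allI ballI)
    fix z assume "z \<in> topspace (prod_topology (top_of_set {0..1::real}) W)"
    then obtain t w where z: "z = (t, w)" and t: "0 \<le> t" "t \<le> 1" and w: "w \<in> topspace W"
      by auto
    have bw: "b w \<in> realization K" and cw: "c w \<in> realization K"
      using b c w by (auto simp: continuous_map_metric_realization)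
    then have pos: "0 \<le> b w v" "0 \<le> c w v" for v
      by (auto simp: realization_def)
    define S where "S = {v. b w v \<noteq> 0} \<union> {v. c w v \<noteq> 0}"
    have S: "finite S" "S \<in> K"
      using K[OF w] bw cw by (auto simp: S_def finite_support_realization)
    have supp: "{v. ?H (t, w) v \<noteq> 0} \<in> K"
    proof -
      consider "t = 0" | "t = 1" | "0 < t" "t < 1"
        using t by linarith
      then show ?thesis
      proof cases
        case 3
        then have "(1 - t) * b w v + t * c w v = 0 \<longleftrightarrow> b w v = 0 \<and> c w v = 0" for v
          using pos[of v] by (simp add: add_nonneg_eq_0_iff)
        then have "{v. ?H (t, w) v \<noteq> 0} = S"
          by (auto simp: S_def)
        then show ?thesis
          using S by simp
      qed (use bw cw in \<open>simp_all add: realization_def\<close>)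
    qed
    have "(\<Sum>v | ?H (t, w) v \<noteq> 0. ?H (t, w) v) = (\<Sum>v\<in>S. ?H (t, w) v)"
      by (rule sum.mono_neutral_left) (use S in \<open>auto simp: S_def\<close>)
    also have "\<dots> = (1 - t) * sum (b w) S + t * sum (c w) S"
      by (simp add: sum.distrib sum_distrib_left)
    also have "\<dots> = 1"
      using sum_realization[OF bw S(1)] sum_realization[OF cw S(1)] by (simp add: S_def)
    finally have "(\<Sum>v | ?H (t, w) v \<noteq> 0. ?H (t, w) v) = 1" .
    with supp t pos show "?H z \<in> realization K"
      by (simp add: z realization_def)
  next
    fix v
    have "continuous_map (prod_topology (top_of_set {0..1::real}) W) euclideanreal (\<lambda>z. d (snd z) v)"
      if "continuous_map W (metric_realization K) d" for d
      using continuous_map_compose[OF continuous_map_snd, of W euclideanreal "\<lambda>w. d w v"] that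
      by (simp add: continuous_map_metric_realization o_def)
    note * = this[OF b] this[OF c]
    have "continuous_map (prod_topology (top_of_set {0..1::real}) W) euclideanreal fst"
      using continuous_map_fst continuous_map_in_subtopology by blast
    then have "continuous_map (prod_topology (top_of_set {0..1::real}) W) euclideanreal
        (\<lambda>z. (1 - fst z) * b (snd z) v + fst z * c (snd z) v)"
      by (intro continuous_intros *)
    then show "continuous_map (prod_topology (top_of_set {0..1::real}) W) euclideanreal (\<lambda>z. ?H z v)"
      by (simp add: case_prod_unfold)
  qed
qed (use A in \<open>auto simp: algebra_simps\<close>)

text \<open>If the supports of \<open>b w\<close> and \<open>c w\<close> always met, both maps could be pushed linearly to the
  normalized pointwise minimum, whose support is the common face.  The minimum, rather than for
  instance the product, makes the homotopy constant where the two maps agree.  Here the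
  supports may be disjoint, but the support of \<open>b w\<close> spans a simplex together with the vertices
  \<open>v\<close> with \<open>u v w \<noteq> 0\<close>, one of which belongs to the support of \<open>c w\<close>.  So the term
  \<open>max 0 (c - b) * u\<close> is added to the minimum; it vanishes where \<open>b\<close> and \<open>c\<close> agree.\<close>

lemma homotopic_with_meeting_supports:
  assumes faces: "\<And>\<sigma> \<tau>. \<lbrakk>\<sigma> \<in> K; \<tau> \<subseteq> \<sigma>; \<tau> \<noteq> {}\<rbrakk> \<Longrightarrow> \<tau> \<in> K"
    and b: "continuous_map W (metric_realization K) b"
    and c: "continuous_map W (metric_realization K) c"
    and "finite T"
    and u: "\<And>v. v \<in> T \<Longrightarrow> continuous_map W euclideanreal (u v)"
    and u0: "\<And>v w. \<lbrakk>v \<in> T; w \<in> topspace W\<rbrakk> \<Longrightarrow> 0 \<le> u v w"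
    and big: "\<And>w. w \<in> topspace W \<Longrightarrow> {v. b w v \<noteq> 0} \<union> {v\<in>T. u v w \<noteq> 0} \<in> K"
    and meet: "\<And>w. w \<in> topspace W \<Longrightarrow> \<exists>v\<in>T. c w v \<noteq> 0 \<and> u v w \<noteq> 0"
    and A: "A \<subseteq> topspace W" "\<And>a. a \<in> A \<Longrightarrow> b a = c a"
  shows "homotopic_with (\<lambda>k. \<forall>a\<in>A. k a = c a) W (metric_realization K) b c"
proof -
  define m where "m w v = min (b w v) (c w v)
      + (if v \<in> T then max 0 (c w v - b w v) * u v w else 0)" for w v
  \<comment> \<open>The total mass of \<open>m w\<close>, written so that its continuity is visible although
    infinitely many coordinates may be involved as \<open>w\<close> varies.\<close>
  define M where "M w = 1 - bary_dist (b w) (c w) / 2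
      + (\<Sum>v\<in>T. max 0 (c w v - b w v) * u v w)" for w
  define n where "n w v = m w v / M w" for w v
  define S where "S w = {v. b w v \<noteq> 0} \<union> {v. c w v \<noteq> 0} \<union> T" for w
  note contb = b[unfolded continuous_map_metric_realization, THEN conjunct2, rule_format]
  note contc = c[unfolded continuous_map_metric_realization, THEN conjunct2, rule_format]
  have real: "b w \<in> realization K" "c w \<in> realization K" if "w \<in> topspace W" for w
    using b c that by (auto simp: continuous_map_metric_realization)
  then have pos: "0 \<le> b w v" "0 \<le> c w v" if "w \<in> topspace W" for w v
    using that by (auto simp: realization_def)
  have finS: "finite (S w)" if "w \<in> topspace W" for w
    using real[OF that] \<open>finite T\<close> by (auto simp: S_def finite_support_realization)
  have m0: "0 \<le> m w v" if "w \<in> topspace W" for w v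
    using pos[OF that] u0[OF _ that] by (auto simp: m_def)
  have msuppS: "v \<in> S w" and msuppc: "c w v \<noteq> 0" and msuppb: "b w v \<noteq> 0 \<or> v \<in> T \<and> u v w \<noteq> 0"
    if "w \<in> topspace W" "m w v \<noteq> 0" for w v
    using that pos[OF that(1), of v] 
    by (auto simp: m_def S_def min_def max_def split: if_splits)
  have M: "M w = sum (m w) (S w)" if w: "w \<in> topspace W" for w
  proof -
    have "bary_dist (b w) (c w) = (\<Sum>v\<in>S w. \<bar>b w v - c w v\<bar>)"
      using finS[OF w] by (intro bary_dist_superset) (auto simp: S_def)
    also have "\<dots> = (\<Sum>v\<in>S w. b w v + c w v - 2 * min (b w v) (c w v))"
      by (intro sum.cong) auto
    also have "\<dots> = 2 - 2 * (\<Sum>v\<in>S w. min (b w v) (c w v))"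
    proof -
      have "sum (b w) (S w) = 1" "sum (c w) (S w) = 1"
        using w real finS by (auto intro!: sum_realization simp: S_def)
      then show ?thesis
        by (simp add: sum.distrib sum_subtractf sum_distrib_left)
    qed
    finally have "1 - bary_dist (b w) (c w) / 2 = (\<Sum>v\<in>S w. min (b w v) (c w v))"
      by linarith
    moreover have "(\<Sum>v\<in>T. max 0 (c w v - b w v) * u v w)
        = (\<Sum>v\<in>S w. if v \<in> T then max 0 (c w v - b w v) * u v w else 0)"
      using finS[OF w] by (intro sum.mono_neutral_cong_left) (auto simp: S_def)
    ultimately show ?thesis
      by (simp add: M_def m_def sum.distrib)
  qed
  have Mpos: "0 < M w" if w: "w \<in> topspace W" for w
  proof -
    obtain v where v: "v \<in> T" "c w v \<noteq> 0" "u v w \<noteq> 0"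
      using meet[OF w] by blast
    have "0 < c w v" "0 < u v w" "0 \<le> b w v"
      using v pos[OF w] u0[OF _ w] by (auto simp: less_le)
    then have "0 < m w v"
      using v(1) by (cases "b w v = 0") (auto simp: m_def add_pos_nonneg)
    also have "m w v \<le> sum (m w) (S w)"
      using v(1) finS[OF w] m0[OF w] by (intro member_le_sum) (auto simp: S_def)
    finally show ?thesis
      by (simp add: M w)
  qed
  have nsupp: "n w v \<noteq> 0 \<longleftrightarrow> m w v \<noteq> 0" if "w \<in> topspace W" for w v
    using Mpos[OF that] by (simp add: n_def)
  have nsum: "sum (n w) {v. n w v \<noteq> 0} = 1" if w: "w \<in> topspace W" for w
  proof -
    have "sum (n w) {v. n w v \<noteq> 0} = sum (n w) (S w)"
      using w nsupp msuppS finS[OF w] by (intro sum.mono_neutral_left) auto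
    also have "\<dots> = 1"
      using Mpos[OF w] by (simp add: n_def M[OF w] flip: sum_divide_distrib)
    finally show ?thesis .
  qed
  then have nne: "{v. n w v \<noteq> 0} \<noteq> {}" if "w \<in> topspace W" for w
    using that by force
  have "continuous_map W euclideanreal (\<lambda>w. n w v)" for v
  proof -
    have "continuous_map W euclideanreal (\<lambda>w. m w v)"
      unfolding m_def by (cases "v \<in> T") (auto intro!: continuous_intros contb contc u)
    moreover have "continuous_map W euclideanreal M"
      unfolding M_def using \<open>finite T\<close>
      by (auto intro!: continuous_intros contb contc u continuous_map_bary_dist[OF b c])
    ultimately show ?thesis
      unfolding n_def by (rule continuous_map_real_divide) (use Mpos in force)
  qed
  moreover have "n w \<in> realization K" if w: "w \<in> topspace W" for w
  proof -
    have "{v. c w v \<noteq> 0} \<in> K"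
      using real(2)[OF w] by (simp add: realization_def)
    moreover have "{v. n w v \<noteq> 0} \<subseteq> {v. c w v \<noteq> 0}"
      using nsupp[OF w] msuppc[OF w] by blast
    ultimately have "{v. n w v \<noteq> 0} \<in> K"
      using nne[OF w] by (rule faces)
    then show ?thesis
      using nsum[OF w] m0[OF w] Mpos[OF w] by (simp add: realization_def n_def)
  qed
  ultimately have n: "continuous_map W (metric_realization K) n"
    by (simp add: continuous_map_metric_realization)
  have nA: "n a = c a" if a: "a \<in> A" for a
  proof
    fix v
    have "M a = 1"
      using A(2)[OF a] by (simp add: M_def bary_dist_def)
    then show "n a v = c a v"
      using A(2)[OF a] by (simp add: n_def m_def)
  qed
  have "homotopic_with (\<lambda>k. \<forall>a\<in>A. k a = c a) W (metric_realization K) b n"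
  proof (rule homotopic_with_linear_realization[OF b n _ A(2) nA])
    fix w assume w: "w \<in> topspace W"
    show "{v. b w v \<noteq> 0} \<union> {v. n w v \<noteq> 0} \<in> K"
      using msuppb[OF w] nsupp[OF w] nne[OF w] by (intro faces[OF big[OF w]]) blast+
  qed
  moreover have "homotopic_with (\<lambda>k. \<forall>a\<in>A. k a = c a) W (metric_realization K) n c"
  proof (rule homotopic_with_linear_realization[OF n c _ nA])
    fix w assume w: "w \<in> topspace W"
    have "{v. n w v \<noteq> 0} \<union> {v. c w v \<noteq> 0} = {v. c w v \<noteq> 0}"
      using msuppc[OF w] nsupp[OF w] by blast
    then show "{v. n w v \<noteq> 0} \<union> {v. c w v \<noteq> 0} \<in> K"
      using real(2)[OF w] by (simp add: realization_def)
  qed auto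
  ultimately show ?thesis
    by (rule homotopic_with_trans)
qed


section \<open>Covering dimension of compact spaces with finitely many coordinates\<close>

lemma covering_dim_le_mono: "covering_dim_le W m \<Longrightarrow> m \<le> n \<Longrightarrow> covering_dim_le W n"
  unfolding covering_dim_le_def
proof (intro allI impI)
  fix \<U>
  assume m: "\<forall>\<U>. finite \<U> \<and> (\<forall>U\<in>\<U>. openin W U) \<and> \<Union>\<U> = topspace W \<longrightarrow>
       (\<exists>\<V>. finite \<V> \<and> (\<forall>V\<in>\<V>. openin W V) \<and> \<Union>\<V> = topspace W \<and>
            (\<forall>V\<in>\<V>. \<exists>U\<in>\<U>. V \<subseteq> U) \<and> (\<forall>x\<in>topspace W. card {V\<in>\<V>. x \<in> V} \<le> m + 1))"
    and "m \<le> n" and \<U>: "finite \<U> \<and> (\<forall>U\<in>\<U>. openin W U) \<and> \<Union>\<U> = topspace W"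
  obtain \<V> where \<V>: "finite \<V> \<and> (\<forall>V\<in>\<V>. openin W V) \<and> \<Union>\<V> = topspace W \<and>
      (\<forall>V\<in>\<V>. \<exists>U\<in>\<U>. V \<subseteq> U) \<and> (\<forall>x\<in>topspace W. card {V\<in>\<V>. x \<in> V} \<le> m + 1)"
    using m[rule_format, OF \<U>] by (rule exE)
  have "card {V\<in>\<V>. x \<in> V} \<le> n + 1" if "x \<in> topspace W" for x
    using bspec[OF \<V>[THEN conjunct2, THEN conjunct2, THEN conjunct2, THEN conjunct2] that] \<open>m \<le> n\<close>
    by linarith
  with \<V> show "\<exists>\<V>. finite \<V> \<and> (\<forall>V\<in>\<V>. openin W V) \<and> \<Union>\<V> = topspace W \<and>
      (\<forall>V\<in>\<V>. \<exists>U\<in>\<U>. V \<subseteq> U) \<and> (\<forall>x\<in>topspace W. card {V\<in>\<V>. x \<in> V} \<le> n + 1)"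
    by (intro exI[of _ \<V>] conjI ballI) simp_all
qed

text \<open>A bound of Lebesgue type, obtained with bricks in several colours: for each colour \<open>j \<le> m\<close> cut
  the coordinate axes at the points \<open>(z + j / (m + 1)) / L\<close>, \<open>z\<close> an integer.  Bricks of one colour
  are disjoint, which bounds the order by the number of colours.  A value of a coordinate is a
  cutting point for at most one colour, so the \<open>m\<close> coordinates of a point exclude at most \<open>m\<close> of
  the \<open>m + 1\<close> colours and the point lies in a brick of a remaining colour.\<close>

lemma separable_metric_dim_le_coordinates:
  fixes W :: "'w topology" and p :: "nat \<Rightarrow> 'w \<Rightarrow> real"
  assumes W: "compact_space W"
    and p: "\<And>i. i < m \<Longrightarrow> continuous_map W euclideanreal (p i)"
    and sep: "\<And>x y. \<lbrakk>x \<in> topspace W; y \<in> topspace W; \<And>i. i < m \<Longrightarrow> p i x = p i y\<rbrakk> \<Longrightarrow> x = y"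
  shows "separable_metric_dim_le m W"
proof -
  define D where "D x y = (\<Sum>i<m. \<bar>p i x - p i y\<bar>)" for x y
  interpret D: Metric_space "topspace W" D
  proof
    show "0 \<le> D x y" "D x y = D y x" for x y
      by (auto simp: D_def sum_nonneg abs_minus_commute)
    show "D x y = 0 \<longleftrightarrow> x = y" if "x \<in> topspace W" "y \<in> topspace W" for x y
      using sep[OF that] by (auto simp: D_def sum_nonneg_eq_0_iff)
    show "D x z \<le> D x y + D y z" for x y z
      unfolding D_def sum.distrib[symmetric] by (rule sum_mono) linarith
  qed
  have top: "D.mtopology = W"
  proof -
    have "continuous_map W D.mtopology id"
      unfolding D.continuous_map_to_metric
    proof (intro ballI allI impI)
      fix x and \<epsilon> :: real
      assume x: "x \<in> topspace W" and "\<epsilon> > 0"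
      have "continuous_map W euclideanreal (D x)"
        unfolding D_def by (intro continuous_intros p) auto
      then have "openin W {y \<in> topspace W. D x y \<in> {..<\<epsilon>}}"
        by (rule openin_continuous_map_preimage) auto
      then show "\<exists>U. openin W U \<and> x \<in> U \<and> (\<forall>y\<in>U. id y \<in> D.mball (id x) \<epsilon>)"
        using x \<open>\<epsilon> > 0\<close> by (intro exI[of _ "{y \<in> topspace W. D x y \<in> {..<\<epsilon>}}"]) auto
    qed
    then have "homeomorphic_map W D.mtopology id"
      by (rule continuous_imp_homeomorphic_map) (use W D.Hausdorff_space_mtopology in auto)
    then show ?thesis
      by simp
  qed
  have compact: "compactin D.mtopology (topspace W)"
    using W by (simp add: top compact_space_def)
  have "metrizable_space W"
    using D.metrizable_space_mtopology by (simp add: top)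
  moreover have "separable_space W"
  proof -
    have "\<exists>C. finite C \<and> C \<subseteq> topspace W \<and> topspace W \<subseteq> (\<Union>x\<in>C. D.mball x (inverse (real (Suc k))))" for k
      using D.compactin_imp_mtotally_bounded[OF compact] unfolding D.mtotally_bounded_def by simp
    then obtain C where C: "\<And>k. finite (C k)" "\<And>k. C k \<subseteq> topspace W"
        "\<And>k. topspace W \<subseteq> (\<Union>x\<in>C k. D.mball x (inverse (real (Suc k))))"
      by metis
    have "topspace W \<subseteq> W closure_of (\<Union>k. C k)"
    proof
      fix x assume x: "x \<in> topspace W"
      have "\<exists>y\<in>\<Union>k. C k. y \<in> D.mball x r" if r: "r > 0" for r
      proof -
        obtain k where "inverse (real (Suc k)) < r"
          using reals_Archimedean[OF r] by blast
        moreover obtain y where y: "y \<in> C k" "x \<in> D.mball y (inverse (real (Suc k)))"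
          using C(3)[of k] x by blast
        moreover have "D x y = D y x"
          by (rule D.commute)
        ultimately have "y \<in> D.mball x r"
          unfolding D.in_mball by (metis order_less_trans)
        then show ?thesis
          using y(1) by blast
      qed
      then show "x \<in> W closure_of (\<Union>k. C k)"
        using x D.metric_closure_of[of "\<Union>k. C k"] by (simp add: top)
    qed
    then show ?thesis
      unfolding separable_space_def
    proof (intro exI conjI)
      show "countable (\<Union>k. C k)"
        using C(1) by (intro countable_UN) (auto intro: countable_finite)
    qed (use C(2) closure_of_subset_topspace[of W "\<Union>k. C k"] in blast)+
  qed
  moreover have "covering_dim_le W m"
    unfolding covering_dim_le_def
  proof (intro allI impI, elim conjE)
    fix \<U> assume \<U>: "finite \<U>" "\<forall>U\<in>\<U>. openin W U" "\<Union>\<U> = topspace W"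
    obtain \<epsilon> where "\<epsilon> > 0" and \<epsilon>: "\<And>x. x \<in> topspace W \<Longrightarrow> \<exists>U\<in>\<U>. D.mball x \<epsilon> \<subseteq> U"
      using D.lebesgue_number[OF compact, of \<U>] \<U> by (auto simp: top)
    obtain L :: nat where "max 0 (real m / \<epsilon>) < real L"
      using reals_Archimedean2 by blast
    then have L: "real m / \<epsilon> < real L" "0 < L"
      by auto
    have L\<epsilon>: "real m / real L < \<epsilon>"
      using L \<open>\<epsilon> > 0\<close> by (simp add: field_simps)
    define s where "s j i x = real L * p i x - real j / real (m + 1)" for j i and x
    define brick where "brick j J = {x \<in> topspace W. \<forall>i<m. of_int (J i) < s j i x \<and> s j i x < of_int (J i) + 1}"
      for j and J :: "nat \<Rightarrow> int"
    have brick_open: "openin W (brick j J)" for j J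
    proof -
      have "openin W {x \<in> topspace W. s j i x \<in> {of_int (J i)<..<of_int (J i) + 1}}" if "i < m" for i
        using that unfolding s_def
        by (intro openin_continuous_map_preimage[where Y = euclideanreal] continuous_intros p) auto
      then have "openin W ((\<Inter>i\<in>{..<m}. {x \<in> topspace W. s j i x \<in> {of_int (J i)<..<of_int (J i) + 1}}) \<inter> topspace W)"
        by (intro openin_INT) auto
      also have "(\<Inter>i\<in>{..<m}. {x \<in> topspace W. s j i x \<in> {of_int (J i)<..<of_int (J i) + 1}}) \<inter> topspace W = brick j J"
        by (auto simp: brick_def)
      finally show ?thesis .
    qed
    have brick_cover: "\<exists>j\<le>m. \<exists>J. x \<in> brick j J" if x: "x \<in> topspace W" for x
    proof -
      define bad where "bad i = {j. j \<le> m \<and> s j i x \<in> \<int>}" for i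
      have "card (bad i) \<le> 1" for i
      proof -
        have "j = j'" if j: "j \<in> bad i" "j' \<in> bad i" for j j'
        proof -
          have "s j i x - s j' i x \<in> \<int>"
            using j by (auto simp: bad_def)
          moreover have "s j i x - s j' i x = (real j' - real j) / real (m + 1)"
            by (simp add: s_def diff_divide_distrib)
          moreover have "\<bar>(real j' - real j) / real (m + 1)\<bar> < 1"
            using j by (auto simp: bad_def abs_less_iff field_simps)
          ultimately have "(real j' - real j) / real (m + 1) = 0"
            using Ints_nonzero_abs_less1 by metis
          then show ?thesis
            by simp
        qed
        then show ?thesis
          by (auto simp: card_le_Suc0_iff_eq bad_def)
      qed
      then have "card (\<Union>i<m. bad i) \<le> m"
        using order_trans[OF card_UN_le[of "{..<m}" bad] sum_bounded_above[of "{..<m}" "\<lambda>i. card (bad i)" 1]]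
        by simp
      then have "\<not> {..m} \<subseteq> (\<Union>i<m. bad i)"
        using card_mono[of "\<Union>i<m. bad i" "{..m}"] by (auto simp: bad_def)
      then obtain j where j: "j \<le> m" "\<And>i. i < m \<Longrightarrow> s j i x \<notin> \<int>"
        by (auto simp: bad_def)
      have "x \<in> brick j (\<lambda>i. \<lfloor>s j i x\<rfloor>)"
        unfolding brick_def
      proof (intro CollectI conjI allI impI x)
        fix i assume "i < m"
        then have "of_int \<lfloor>s j i x\<rfloor> \<noteq> s j i x"
          using j(2) by (metis Ints_of_int)
        then show "of_int \<lfloor>s j i x\<rfloor> < s j i x"
          by (simp add: less_le)
      qed linarith
      then show ?thesis
        using j(1) by blast
    qed
    have brick_unique: "brick j J = brick j (\<lambda>i. \<lfloor>s j i x\<rfloor>)" if "x \<in> brick j J" for x j J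
    proof -
      have "\<lfloor>s j i x\<rfloor> = J i" if "i < m" for i
        using that \<open>x \<in> brick j J\<close> by (intro floor_unique) (auto simp: brick_def)
      then show ?thesis
        by (auto simp: brick_def)
    qed
    have brick_small: "brick j J \<subseteq> D.mball x \<epsilon>" if x: "x \<in> brick j J" for x j J
    proof
      fix y assume y: "y \<in> brick j J"
      have "D x y \<le> (\<Sum>i<m. 1 / real L)"
        unfolding D_def
      proof (rule sum_mono)
        fix i assume "i \<in> {..<m}"
        then have "of_int (J i) < s j i x" "s j i x < of_int (J i) + 1"
            "of_int (J i) < s j i y" "s j i y < of_int (J i) + 1"
          using x y by (auto simp: brick_def)
        then have "\<bar>s j i x - s j i y\<bar> < 1"
          by linarith
        moreover have "s j i x - s j i y = real L * (p i x - p i y)"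
          by (simp add: s_def algebra_simps)
        ultimately have "real L * \<bar>p i x - p i y\<bar> < 1"
          by (simp add: abs_mult)
        then show "\<bar>p i x - p i y\<bar> \<le> 1 / real L"
          using L(2) by (simp add: field_simps)
      qed
      then show "y \<in> D.mball x \<epsilon>"
        using x y L\<epsilon> by (auto simp: brick_def)
    qed
    \<comment> \<open>The empty brick is excluded because \<open>\<U>\<close> may be empty.\<close>
    define \<B> where "\<B> = {brick j J | j J. j \<le> m} - {{}}"
    have "(\<forall>V\<in>\<B>. openin W V) \<and> topspace W \<subseteq> \<Union>\<B>"
      using brick_cover brick_open by (fastforce simp: \<B>_def)
    then obtain \<V> where \<V>: "finite \<V>" "\<V> \<subseteq> \<B>" "topspace W \<subseteq> \<Union>\<V>"
      using W unfolding compact_space_alt by meson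
    have "\<exists>U\<in>\<U>. V \<subseteq> U" if "V \<in> \<V>" for V
    proof -
      have "V \<in> \<B>"
        using \<open>V \<in> \<V>\<close> \<V>(2) by blast
      then obtain j J x where V: "V = brick j J" and x: "x \<in> V"
        unfolding \<B>_def by blast
      then obtain U where "U \<in> \<U>" "D.mball x \<epsilon> \<subseteq> U"
        using \<epsilon>[of x] by (auto simp: brick_def)
      then show ?thesis
        using brick_small[of x j J] x V by blast
    qed
    moreover have "card {V\<in>\<V>. x \<in> V} \<le> m + 1" for x
    proof -
      have "{V\<in>\<V>. x \<in> V} \<subseteq> (\<lambda>j. brick j (\<lambda>i. \<lfloor>s j i x\<rfloor>)) ` {..m}"
        using \<V>(2) brick_unique[of x] by (fastforce simp: \<B>_def)
      then have "card {V\<in>\<V>. x \<in> V} \<le> card {..m}"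
        by (rule surj_card_le[rotated]) simp
      then show ?thesis
        by simp
    qed
    moreover have "\<forall>V\<in>\<V>. openin W V" "\<Union>\<V> = topspace W"
      using \<V> brick_open by (force simp: \<B>_def brick_def)+
    ultimately show "\<exists>\<V>. finite \<V> \<and> (\<forall>V\<in>\<V>. openin W V) \<and> \<Union>\<V> = topspace W \<and>
        (\<forall>V\<in>\<V>. \<exists>U\<in>\<U>. V \<subseteq> U) \<and> (\<forall>x\<in>topspace W. card {V\<in>\<V>. x \<in> V} \<le> m + 1)"
      using \<V>(1) by blast
  qed
  ultimately show ?thesis
    by (simp add: separable_metric_dim_le_def)
qed

lemma topspace_cube: "topspace (cube k) = (\<Pi>\<^sub>E i\<in>{..<k}. {0..1})"
  by (simp add: cube_def)

lemma continuous_map_cube_coordinate: "i < k \<Longrightarrow> continuous_map (cube k) euclideanreal (\<lambda>t. t i)"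
  unfolding cube_def
  by (metis continuous_map_in_subtopology continuous_map_product_projection lessThan_iff)

lemma compact_space_interval: "compact_space (top_of_set {0..1::real})"
  by (simp add: compact_space_subtopology)

lemma compact_space_cube: "compact_space (cube k)"
  by (simp add: cube_def compact_space_product_topology compact_space_interval)

lemma separable_metric_dim_le_cube: "separable_metric_dim_le k (cube k)"
proof (rule separable_metric_dim_le_coordinates[where p = "\<lambda>i t. t i"])
  fix x y assume xy: "x \<in> topspace (cube k)" "y \<in> topspace (cube k)" "\<And>i. i < k \<Longrightarrow> x i = y i"
  then show "x = y"
    by (intro PiE_ext[of x "{..<k}" _ y]) (auto simp: topspace_cube)
qed (auto simp: compact_space_cube continuous_map_cube_coordinate)

lemma separable_metric_dim_le_interval: "separable_metric_dim_le 1 (top_of_set {0..1::real})"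
  by (rule separable_metric_dim_le_coordinates[where p = "\<lambda>_ t. t"])
     (auto simp: compact_space_interval)

lemma continuous_map_cylinder_time:
  "continuous_map (prod_topology (top_of_set {0..1::real}) Y) euclideanreal fst"
  using continuous_map_fst continuous_map_in_subtopology by blast

lemma separable_metric_dim_le_cylinder:
  "separable_metric_dim_le (Suc k) (prod_topology (top_of_set {0..1::real}) (cube k))"
proof (rule separable_metric_dim_le_coordinates
    [where p = "\<lambda>i z. case i of 0 \<Rightarrow> fst z | Suc j \<Rightarrow> snd z j"])
  show "compact_space (prod_topology (top_of_set {0..1::real}) (cube k))"
    by (simp add: compact_space_prod_topology compact_space_interval compact_space_cube)
  show "continuous_map (prod_topology (top_of_set {0..1}) (cube k)) euclideanreal
      (\<lambda>z. case i of 0 \<Rightarrow> fst z | Suc j \<Rightarrow> snd z j)" if "i < Suc k" for i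
    using that continuous_map_compose[OF continuous_map_snd continuous_map_cube_coordinate]
    by (cases i) (auto simp: continuous_map_cylinder_time o_def)
next
  fix x y assume xy: "x \<in> topspace (prod_topology (top_of_set {0..1::real}) (cube k))"
    "y \<in> topspace (prod_topology (top_of_set {0..1::real}) (cube k))"
    "\<And>i. i < Suc k \<Longrightarrow> (case i of 0 \<Rightarrow> fst x | Suc j \<Rightarrow> snd x j) = (case i of 0 \<Rightarrow> fst y | Suc j \<Rightarrow> snd y j)"
  have "fst x = fst y"
    using xy(3)[of 0] by simp
  moreover have "snd x = snd y"
    using xy(1,2) xy(3)[of "Suc _"]
    by (intro PiE_ext[of "snd x" "{..<k}" _ "snd y"]) (auto simp: topspace_cube)
  ultimately show "x = y"
    by (simp add: prod_eq_iff)
qed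

lemma separable_metric_dim_le_mono:
  "separable_metric_dim_le m W \<Longrightarrow> m \<le> n \<Longrightarrow> separable_metric_dim_le n W"
  using covering_dim_le_mono by (auto simp: separable_metric_dim_le_def)


section \<open>Extending maps subject to a cover\<close>

text \<open>The extension is constructed over the closed strata \<open>B s\<close>, consisting of the points that lie in
  \<open>Q F\<close> for no \<open>F\<close> outside \<open>s\<close>, in order of growing \<open>s\<close>.  A map defined over the smaller strata
  sends the part of \<open>B s\<close> on which it is defined into \<open>\<Union>s\<close>, within which it can be extended.
  The remaining points of \<open>B s\<close> lie in \<open>Q F\<close> for all \<open>F\<close> in \<open>s\<close>, so there every value in \<open>\<Union>s\<close>
  is admissible.\<close>

lemma extension_subordinate_to_cover:
  fixes W :: "'w topology" and Y :: "'a topology" and T :: "'a set set"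
  assumes "finite T"
    and Q_open: "\<And>F. F \<in> T \<Longrightarrow> openin W (Q F)"
    and Q_cover: "\<And>w. w \<in> topspace W \<Longrightarrow> {F\<in>T. w \<in> Q F} \<noteq> {}"
    and ext: "\<And>w s. \<lbrakk>w \<in> topspace W; s = {F\<in>T. w \<in> Q F}\<rbrakk> \<Longrightarrow> absolute_extensor_for (subtopology Y (\<Union>s)) W"
    and A: "closedin W A"
    and f: "continuous_map (subtopology W A) Y f"
    and fQ: "\<And>a. a \<in> A \<Longrightarrow> f a \<in> \<Union>{F\<in>T. a \<in> Q F}"
  obtains g where "continuous_map W Y g" "\<And>a. a \<in> A \<Longrightarrow> g a = f a"
    "\<And>w. w \<in> topspace W \<Longrightarrow> g w \<in> \<Union>{F\<in>T. w \<in> Q F}"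
proof -
  define S where "S w = {F\<in>T. w \<in> Q F}" for w
  define B where "B s = {w \<in> topspace W. S w \<subseteq> s}" for s
  define dom where "dom \<S> = A \<union> (\<Union>s\<in>\<S>. B s)" for \<S>
  have AW: "A \<subseteq> topspace W"
    using A by (rule closedin_subset)
  have B_closed: "closedin W (B s)" for s
  proof -
    have "closedin W (topspace W - (\<Union>F\<in>T - s. Q F))"
      using Q_open by (intro closedin_diff closedin_topspace openin_Union) auto
    also have "topspace W - (\<Union>F\<in>T - s. Q F) = B s"
      by (auto simp: B_def S_def)
    finally show ?thesis .
  qed
  have dom_closed: "closedin W (dom \<S>)" if "finite \<S>" for \<S>
    unfolding dom_def using A B_closed that by (intro closedin_Un closedin_Union) auto
  have "\<exists>g. continuous_map (subtopology W (dom \<S>)) Y g \<and> (\<forall>a\<in>A. g a = f a) \<and> (\<forall>w\<in>dom \<S>. g w \<in> \<Union>(S w))"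
    if "finite \<S>" "\<And>s s'. \<lbrakk>s \<in> \<S>; s' \<subseteq> s\<rbrakk> \<Longrightarrow> s' \<in> \<S>" for \<S>
    using that
  proof (induction \<S> rule: finite_psubset_induct)
    case (psubset \<S>)
    show ?case
    proof (cases "\<S> = {}")
      case True
      then show ?thesis
        using f fQ by (auto simp: dom_def S_def)
    next
      case False
      then obtain s where s: "s \<in> \<S>" and s_max: "\<And>s'. \<lbrakk>s' \<in> \<S>; s \<subseteq> s'\<rbrakk> \<Longrightarrow> s = s'"
        using finite_has_maximal[OF psubset.hyps] by blast
      define \<S>' where "\<S>' = \<S> - {s}"
      define D where "D = dom \<S>'"
      have "\<S>' \<subset> \<S>" and down: "\<And>r r'. \<lbrakk>r \<in> \<S>'; r' \<subseteq> r\<rbrakk> \<Longrightarrow> r' \<in> \<S>'"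
        using s s_max psubset.prems by (auto simp: \<S>'_def)
      have "\<exists>g. continuous_map (subtopology W D) Y g \<and> (\<forall>a\<in>A. g a = f a) \<and> (\<forall>w\<in>D. g w \<in> \<Union>(S w))"
        unfolding D_def by (rule psubset.IH[OF \<open>\<S>' \<subset> \<S>\<close>]) (rule down)
      then obtain g0 where "continuous_map (subtopology W D) Y g0 \<and> (\<forall>a\<in>A. g0 a = f a) \<and> (\<forall>w\<in>D. g0 w \<in> \<Union>(S w))"
        by (rule exE)
      then have g0: "continuous_map (subtopology W D) Y g0" "\<And>a. a \<in> A \<Longrightarrow> g0 a = f a"
          "\<And>w. w \<in> D \<Longrightarrow> g0 w \<in> \<Union>(S w)"
        by (simp_all del: Union_iff)
      have D_closed: "closedin W D"
        using psubset.hyps by (auto simp: D_def \<S>'_def intro: dom_closed)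
      have dom_eq: "dom \<S> = D \<union> B s"
        using s by (auto simp: dom_def D_def \<S>'_def)
      have new: "S w = s" if "w \<in> B s" "w \<notin> D" for w
      proof (rule ccontr)
        assume "S w \<noteq> s"
        then have "S w \<in> \<S>'"
          using that(1) s psubset.prems by (auto simp: \<S>'_def B_def)
        moreover have "w \<in> B (S w)"
          using that(1) by (simp add: B_def)
        ultimately show False
          using that(2) by (auto simp: D_def dom_def)
      qed
      show ?thesis
      proof (cases "\<exists>w\<in>B s. w \<notin> D")
        case False
        then have "dom \<S> = D"
          using dom_eq by blast
        then show ?thesis
          using g0 by auto
      next
        case True
        then obtain w0 where "w0 \<in> topspace W" "s = {F\<in>T. w0 \<in> Q F}"
          using new by (auto simp: B_def S_def)
        then have ext_s: "absolute_extensor_for (subtopology Y (\<Union>s)) W"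
          by (rule ext)
        have "continuous_map (subtopology W (D \<inter> B s)) (subtopology Y (\<Union>s)) g0"
        proof (rule continuous_map_into_subtopology)
          show "continuous_map (subtopology W (D \<inter> B s)) Y g0"
            using g0(1) by (rule continuous_map_from_subtopology_mono) auto
          show "g0 \<in> topspace (subtopology W (D \<inter> B s)) \<rightarrow> \<Union>s"
            using g0(3) by (fastforce simp: B_def)
        qed
        moreover have "closedin W (D \<inter> B s)"
          using D_closed B_closed by blast
        ultimately obtain e where "continuous_map W (subtopology Y (\<Union>s)) e \<and> (\<forall>w\<in>D \<inter> B s. e w = g0 w)"
          using ext_s[unfolded absolute_extensor_for_def, rule_format, of "D \<inter> B s" g0] by fast
        then have e: "continuous_map W (subtopology Y (\<Union>s)) e" "\<And>w. w \<in> D \<inter> B s \<Longrightarrow> e w = g0 w"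
          by blast+
        define g where "g w = (if w \<in> D then g0 w else e w)" for w
        have eY: "continuous_map W Y e" and es: "\<And>w. w \<in> topspace W \<Longrightarrow> e w \<in> \<Union>s"
          using e(1) by (auto simp: continuous_map_in_subtopology)
        have gB: "g w = e w" if "w \<in> B s" for w
          using e(2) that by (simp add: g_def)
        have "continuous_map (subtopology W (dom \<S>)) Y g"
        proof (rule pasting_lemma_closed[where I = "UNIV :: bool set"
              and T = "\<lambda>i. if i then D else B s" and f = "\<lambda>i. if i then g0 else e"])
          fix i :: bool
          show "closedin (subtopology W (dom \<S>)) (if i then D else B s)"
            using D_closed B_closed by (auto simp: dom_eq intro: closedin_subset_topspace)
          have "continuous_map (subtopology W (B s)) Y e"
            using eY by (rule continuous_map_from_subtopology)
          then show "continuous_map (subtopology (subtopology W (dom \<S>)) (if i then D else B s)) Y (if i then g0 else e)"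
            using g0(1) by (simp add: subtopology_subtopology dom_eq Int_absorb1)
        next
          fix x assume "x \<in> topspace (subtopology W (dom \<S>))"
          then show "\<exists>j. j \<in> UNIV \<and> x \<in> (if j then D else B s) \<and> g x = (if j then g0 else e) x"
            using gB by (intro exI[of _ "x \<in> D"]) (auto simp: dom_eq g_def)
        qed (use e(2) in auto)
        moreover have "g a = f a" if "a \<in> A" for a
          using that g0(2) by (simp add: g_def D_def dom_def)
        moreover have "g w \<in> \<Union>(S w)" if "w \<in> dom \<S>" for w
        proof (cases "w \<in> D")
          case False
          then have "w \<in> B s" "S w = s"
            using that new by (auto simp: dom_eq)
          then show ?thesis
            using False es[of w] by (simp add: g_def B_def)
        qed (use g0(3) in \<open>simp add: g_def\<close>)
        ultimately show ?thesis
          by blast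
      qed
    qed
  qed
  from this[of "Pow T"] have "\<exists>g. continuous_map (subtopology W (dom (Pow T))) Y g
      \<and> (\<forall>a\<in>A. g a = f a) \<and> (\<forall>w\<in>dom (Pow T). g w \<in> \<Union>(S w))"
    using \<open>finite T\<close> by (simp add: subset_trans del: Union_iff)
  then obtain g where "continuous_map (subtopology W (dom (Pow T))) Y g
      \<and> (\<forall>a\<in>A. g a = f a) \<and> (\<forall>w\<in>dom (Pow T). g w \<in> \<Union>(S w))"
    by (rule exE)
  then have g: "continuous_map (subtopology W (dom (Pow T))) Y g"
      "\<And>a. a \<in> A \<Longrightarrow> g a = f a" "\<And>w. w \<in> dom (Pow T) \<Longrightarrow> g w \<in> \<Union>(S w)"
    by (simp_all del: Union_iff)
  have "dom (Pow T) = topspace W"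
    using AW by (auto simp: dom_def B_def S_def)
  then show thesis
    using that[of g] g by (simp add: S_def del: Union_iff)
qed


section \<open>Relative lifting up to homotopy\<close>

lemma canonical_map_coordinate:
  assumes "canonical_map X \<F> \<kappa>" "x \<in> topspace X" "\<kappa> x F \<noteq> 0"
  shows "F \<in> \<F>" "x \<in> F"
proof -
  obtain \<phi> where "partition_of_unity_subordinated X \<F> \<phi>" "\<kappa> x = (\<lambda>F. if F \<in> \<F> then \<phi> F x else 0)"
    using assms(1,2) by (auto simp: canonical_map_def)
  then show "F \<in> \<F>" "x \<in> F"
    using assms(2,3) unfolding partition_of_unity_subordinated_def by (metis, metis DiffI)
qed

lemma continuous_map_canonical_map:
  assumes "canonical_map X \<F> \<kappa>"
  shows "continuous_map X (metric_realization (nerve \<F>)) \<kappa>"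
  unfolding continuous_map_metric_realization
proof (intro conjI ballI allI)
  obtain \<phi> where \<phi>: "partition_of_unity_subordinated X \<F> \<phi>"
      "\<And>x. x \<in> topspace X \<Longrightarrow> \<kappa> x = (\<lambda>F. if F \<in> \<F> then \<phi> F x else 0)"
    using assms by (auto simp: canonical_map_def)
  show "continuous_map X euclideanreal (\<lambda>x. \<kappa> x F)" for F
  proof (rule continuous_map_eq)
    show "continuous_map X euclideanreal (\<lambda>x. if F \<in> \<F> then \<phi> F x else 0)"
      using \<phi>(1) by (cases "F \<in> \<F>") (auto simp: partition_of_unity_subordinated_def)
  qed (simp add: \<phi>(2))
  fix x assume x: "x \<in> topspace X"
  have supp: "{F. \<kappa> x F \<noteq> 0} = {F. F \<in> \<F> \<and> \<phi> F x \<noteq> 0}"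
    using \<phi>(2)[OF x] by auto
  have one: "(\<Sum>F | F \<in> \<F> \<and> \<phi> F x \<noteq> 0. \<phi> F x) = 1"
    using \<phi>(1) x by (simp add: partition_of_unity_subordinated_def)
  have "finite {F. \<kappa> x F \<noteq> 0}"
    unfolding supp by (rule ccontr) (use one in simp)
  moreover have "{F. \<kappa> x F \<noteq> 0} \<noteq> {}"
    unfolding supp by (rule notI) (use one in simp)
  moreover have "x \<in> \<Inter>{F. \<kappa> x F \<noteq> 0}" "{F. \<kappa> x F \<noteq> 0} \<subseteq> \<F>"
    using canonical_map_coordinate[OF assms x] by auto
  ultimately have "{F. \<kappa> x F \<noteq> 0} \<in> nerve \<F>"
    unfolding nerve_def by blast
  moreover have "(\<Sum>F | \<kappa> x F \<noteq> 0. \<kappa> x F) = 1"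
    unfolding supp one[symmetric] by (rule sum.cong) (simp_all add: \<phi>(2)[OF x])
  ultimately show "\<kappa> x \<in> realization (nerve \<F>)"
    using \<phi> x by (auto simp: realization_def partition_of_unity_subordinated_def)
qed

text \<open>The distance to the complement, unless that is empty.\<close>

lemma positive_function_on_open_set:
  fixes X :: "'a metric"
  assumes "openin (mtopology_of X) F"
  obtains u where "continuous_map (mtopology_of X) euclideanreal u"
    "\<And>x. x \<in> mspace X \<Longrightarrow> 0 \<le> u x" "\<And>x. x \<in> mspace X \<Longrightarrow> u x \<noteq> 0 \<longleftrightarrow> x \<in> F"
proof (cases "mspace X \<subseteq> F")
  case True
  then show thesis
    by (intro that[of "\<lambda>_. 1"]) auto
next
  case False
  define C where "C = mspace X - F"
  have C: "C \<noteq> {}" "C \<subseteq> mspace X"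
    using False by (auto simp: C_def)
  define u where "u x = (INF y\<in>C. mdist X x y)" for x
  have bdd: "bdd_below (mdist X x ` C)" for x
    by (rule bdd_belowI2[of _ 0]) simp
  have u0: "0 \<le> u x" for x
    unfolding u_def using C by (intro cINF_greatest) auto
  have u_le: "u x \<le> mdist X x z + u z" if "x \<in> mspace X" "z \<in> mspace X" for x z
  proof -
    have "u x - mdist X x z \<le> mdist X z y" if y: "y \<in> C" for y
    proof -
      have "u x \<le> mdist X x y"
        unfolding u_def by (rule cINF_lower[OF bdd y])
      also have "\<dots> \<le> mdist X x z + mdist X z y"
        using \<open>x \<in> mspace X\<close> \<open>z \<in> mspace X\<close> y C by (intro mdist_triangle) auto
      finally show ?thesis
        by simp
    qed
    then have "u x - mdist X x z \<le> u z"
      unfolding u_def[of z] using C by (intro cINF_greatest) auto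
    then show ?thesis
      by simp
  qed
  have "Lipschitz_continuous_map X euclidean_metric u"
    unfolding Lipschitz_continuous_map_def
  proof (intro conjI exI[of _ 1] ballI)
    fix x y assume "x \<in> mspace X" "y \<in> mspace X"
    then show "mdist euclidean_metric (u x) (u y) \<le> 1 * mdist X x y"
      using u_le[of x y] u_le[of y x] by (simp add: dist_real_def mdist_commute)
  qed simp
  then have "continuous_map (mtopology_of X) euclideanreal u"
    using Lipschitz_continuous_imp_continuous_map by fastforce
  moreover have "u x \<noteq> 0 \<longleftrightarrow> x \<in> F" if x: "x \<in> mspace X" for x
  proof
    assume "u x \<noteq> 0"
    show "x \<in> F"
    proof (rule ccontr)
      assume "x \<notin> F"
      then have "x \<in> C"
        using x by (simp add: C_def)
      from cINF_lower[OF bdd[of x] this] have "u x \<le> mdist X x x"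
        by (simp add: u_def)
      then have "u x \<le> 0"
        using Metric_space.mdist_zero[OF Metric_space_mspace_mdist x] by simp
      with u0[of x] \<open>u x \<noteq> 0\<close> show False
        by simp
    qed
  next
    assume "x \<in> F"
    interpret X: Metric_space "mspace X" "mdist X"
      by simp
    obtain r where "r > 0" and r: "X.mball x r \<subseteq> F"
      using assms \<open>x \<in> F\<close> unfolding mtopology_of_def X.openin_mtopology by blast
    then have "r \<le> mdist X x y" if "y \<in> C" for y
      using that x C by (force simp: C_def not_le[symmetric])
    then have "r \<le> u x"
      unfolding u_def using C by (intro cINF_greatest) auto
    then show "u x \<noteq> 0"
      using \<open>r > 0\<close> by simp
  qed
  ultimately show thesis
    using that u0 by blast
qed

text \<open>Compactness of \<open>W\<close> reduces the pulled back stars \<open>Q F = {w. h w F \<noteq> 0}\<close> to a finite subcover.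
  A value \<open>g w\<close> in some \<open>F\<close> with \<open>h w F \<noteq> 0\<close> puts \<open>\<kappa> (g w)\<close> and \<open>h w\<close> into the closed star of the
  common vertex \<open>F\<close>.  As \<open>\<kappa> (g w) F\<close> may be \<open>0\<close> nevertheless, the functions \<open>u F\<close>, positive exactly
  on \<open>F\<close>, are needed to move \<open>\<kappa> (g w)\<close> towards that vertex.\<close>

lemma relative_homotopy_lifting:
  fixes X :: "'a metric" and W :: "'w topology"
  assumes wr: "weakly_regular_cover (separable_metric_spaces_dim_le n) (mtopology_of X) \<F>"
    and \<kappa>: "canonical_map (mtopology_of X) \<F> \<kappa>"
    and W: "compact_space W" "separable_metric_dim_le n W"
    and A: "closedin W A"
    and f: "continuous_map (subtopology W A) (mtopology_of X) f"
    and h: "continuous_map W (metric_realization (nerve \<F>)) h"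
    and hf: "\<And>a. a \<in> A \<Longrightarrow> h a = \<kappa> (f a)"
  obtains g where "continuous_map W (mtopology_of X) g" "\<And>a. a \<in> A \<Longrightarrow> g a = f a"
    "homotopic_with (\<lambda>k. \<forall>a\<in>A. k a = h a) W (metric_realization (nerve \<F>)) (\<kappa> \<circ> g) h"
proof -
  have \<F>_open: "openin (mtopology_of X) F" if "F \<in> \<F>" for F
    using wr that by (simp add: weakly_regular_cover_def)
  have hN: "h w \<in> realization (nerve \<F>)" if "w \<in> topspace W" for w
    using h that by (simp add: continuous_map_metric_realization)
  have AW: "A \<subseteq> topspace W"
    using A by (rule closedin_subset)
  have fX: "f a \<in> mspace X" if "a \<in> A" for a
    using f that AW by (force simp: continuous_map_def)
  define Q where "Q F = {w \<in> topspace W. h w F \<in> - {0}}" for F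
  have Q_open: "openin W (Q F)" for F
    unfolding Q_def using h
    by (intro openin_continuous_map_preimage[where Y = euclideanreal])
       (auto simp: continuous_map_metric_realization)
  have "topspace W \<subseteq> \<Union>(Q ` \<F>)"
  proof
    fix w assume w: "w \<in> topspace W"
    then have "{F. h w F \<noteq> 0} \<noteq> {}" "{F. h w F \<noteq> 0} \<subseteq> \<F>"
      using hN[OF w] by (auto simp: realization_def nerve_def)
    then show "w \<in> \<Union>(Q ` \<F>)"
      using w by (auto simp: Q_def)
  qed
  then obtain \<V> where "finite \<V>" "\<V> \<subseteq> Q ` \<F>" "topspace W \<subseteq> \<Union>\<V>"
    using W(1) Q_open unfolding compact_space_alt by (metis (no_types, lifting) imageE)
  then obtain T where T: "finite T" "T \<subseteq> \<F>" "topspace W \<subseteq> \<Union>(Q ` T)"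
    by (metis finite_subset_image)
  define S where "S w = {F\<in>T. w \<in> Q F}" for w
  have S_ne: "S w \<noteq> {}" if "w \<in> topspace W" for w
    using T(3) that by (auto simp: S_def)
  obtain g where g: "continuous_map W (mtopology_of X) g" "\<And>a. a \<in> A \<Longrightarrow> g a = f a"
    "\<And>w. w \<in> topspace W \<Longrightarrow> g w \<in> \<Union>(S w)"
  proof (rule extension_subordinate_to_cover[OF T(1), where Q = Q and W = W and Y = "mtopology_of X", OF Q_open _ _ A f])
    fix w s assume w: "w \<in> topspace W" and s: "s = {F\<in>T. w \<in> Q F}"
    have "s \<noteq> {}" "s \<subseteq> \<F>" "\<Inter>{F. h w F \<noteq> 0} \<noteq> {}" "s \<subseteq> {F. h w F \<noteq> 0}"
      using hN[OF w] T(2) S_ne[OF w] by (auto simp: s S_def realization_def nerve_def Q_def)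
    then have "s \<subseteq> \<F>" "s \<noteq> {} \<and> \<Inter>s \<noteq> {}"
      using Inter_anti_mono[of s "{F. h w F \<noteq> 0}"] by auto
    then have "absolute_extensors (separable_metric_spaces_dim_le n) (subtopology (mtopology_of X) (\<Union>s))"
      using wr by (simp add: weakly_regular_cover_def weak_AE_cover_def)
    then show "absolute_extensor_for (subtopology (mtopology_of X) (\<Union>s)) W"
      using W(2) by (rule absolute_extensors_universal)
  next
    fix a assume a: "a \<in> A"
    then obtain F where F: "F \<in> S a"
      using S_ne AW by blast
    then have "\<kappa> (f a) F \<noteq> 0"
      using hf[OF a] by (simp add: S_def Q_def)
    then have "f a \<in> F"
      using canonical_map_coordinate[OF \<kappa>] fX[OF a] by simp
    then show "f a \<in> \<Union>{F \<in> T. a \<in> Q F}"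
      using F by (auto simp: S_def)
  qed (use S_ne in \<open>auto simp: S_def\<close>)
  have gX: "g w \<in> mspace X" if "w \<in> topspace W" for w
    using g(1) that by (force simp: continuous_map_def)
  have "\<exists>u. continuous_map (mtopology_of X) euclideanreal u \<and> (\<forall>x\<in>mspace X. 0 \<le> u x)
      \<and> (\<forall>x\<in>mspace X. u x \<noteq> 0 \<longleftrightarrow> x \<in> F)" if "F \<in> T" for F
    using positive_function_on_open_set[OF \<F>_open] that T(2) by (metis subsetD)
  then obtain u where u: "\<And>F. F \<in> T \<Longrightarrow> continuous_map (mtopology_of X) euclideanreal (u F)"
      "\<And>F x. \<lbrakk>F \<in> T; x \<in> mspace X\<rbrakk> \<Longrightarrow> 0 \<le> u F x"
      "\<And>F x. \<lbrakk>F \<in> T; x \<in> mspace X\<rbrakk> \<Longrightarrow> u F x \<noteq> 0 \<longleftrightarrow> x \<in> F"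
    by metis
  have \<kappa>g: "continuous_map W (metric_realization (nerve \<F>)) (\<kappa> \<circ> g)"
    using g(1) continuous_map_canonical_map[OF \<kappa>] by (rule continuous_map_compose)
  have "homotopic_with (\<lambda>k. \<forall>a\<in>A. k a = h a) W (metric_realization (nerve \<F>)) (\<kappa> \<circ> g) h"
  proof (rule homotopic_with_meeting_supports[OF _ \<kappa>g h T(1), where u = "\<lambda>F w. u F (g w)"])
    show "\<tau> \<in> nerve \<F>" if "\<sigma> \<in> nerve \<F>" "\<tau> \<subseteq> \<sigma>" "\<tau> \<noteq> {}" for \<sigma> \<tau>
      using that Inter_anti_mono[of \<tau> \<sigma>] finite_subset[of \<tau> \<sigma>] by (auto simp: nerve_def)
    show "continuous_map W euclideanreal (\<lambda>w. u F (g w))" if "F \<in> T" for F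
      using continuous_map_compose[OF g(1) u(1)[OF that]] by (simp add: o_def)
    fix w assume w: "w \<in> topspace W"
    show "0 \<le> u F (g w)" if "F \<in> T" for F
      using u(2) that gX[OF w] by blast
    show "\<exists>F\<in>T. h w F \<noteq> 0 \<and> u F (g w) \<noteq> 0"
      using g(3)[OF w] u(3) gX[OF w] by (auto simp: S_def Q_def)
    have "{F. \<kappa> (g w) F \<noteq> 0} \<in> nerve \<F>"
      using \<kappa>g w by (auto simp: continuous_map_metric_realization realization_def)
    moreover have "g w \<in> F" if "\<kappa> (g w) F \<noteq> 0" for F
      using canonical_map_coordinate(2)[OF \<kappa>] gX[OF w] that by simp
    ultimately have "g w \<in> \<Inter>({F. \<kappa> (g w) F \<noteq> 0} \<union> {F\<in>T. u F (g w) \<noteq> 0})"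
        "{F. \<kappa> (g w) F \<noteq> 0} \<union> {F\<in>T. u F (g w) \<noteq> 0} \<subseteq> \<F>"
        "finite ({F. \<kappa> (g w) F \<noteq> 0} \<union> {F\<in>T. u F (g w) \<noteq> 0})"
        "{F. \<kappa> (g w) F \<noteq> 0} \<union> {F\<in>T. u F (g w) \<noteq> 0} \<noteq> {}"
      using T(1,2) u(3) gX[OF w] by (auto simp: nerve_def)
    then show "{F. (\<kappa> \<circ> g) w F \<noteq> 0} \<union> {F\<in>T. u F (g w) \<noteq> 0} \<in> nerve \<F>"
      unfolding nerve_def o_def by blast
  qed (use AW g(2) hf in auto)
  with g(1,2) show thesis
    by (rule that)
qed


section \<open>Spheroids and their joins\<close>

lemma cube_boundary_subset: "cube_boundary k \<subseteq> topspace (cube k)"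
  by (auto simp: cube_boundary_def)

lemma closedin_cube_boundary: "closedin (cube k) (cube_boundary k)"
proof -
  have "closedin (cube k) {t \<in> topspace (cube k). t i \<in> {0, 1}}" if "i < k" for i
    by (rule closedin_continuous_map_preimage[OF continuous_map_cube_coordinate[OF that]]) auto
  then have "closedin (cube k) (\<Union>i\<in>{..<k}. {t \<in> topspace (cube k). t i \<in> {0, 1}})"
    by (intro closedin_Union) auto
  also have "(\<Union>i\<in>{..<k}. {t \<in> topspace (cube k). t i \<in> {0, 1}}) = cube_boundary k"
    by (auto simp: cube_boundary_def)
  finally show ?thesis .
qed

lemma homotopic_rel_iff:
  fixes Z :: "'z topology" and a :: 'a
  assumes "B \<subseteq> topspace Z"
  shows "homotopic_with (\<lambda>h. \<forall>t\<in>B. h t = a) Z Y f g \<longleftrightarrow>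
    (\<exists>H. continuous_map (prod_topology (top_of_set {0..1::real}) Z) Y H \<and>
       (\<forall>t\<in>topspace Z. H (0, t) = f t) \<and> (\<forall>t\<in>topspace Z. H (1, t) = g t) \<and>
       (\<forall>s\<in>{0..1}. \<forall>t\<in>B. H (s, t) = a))"
proof (rule homotopic_with)
  fix h k :: "'z \<Rightarrow> 'a" assume "\<And>t. t \<in> topspace Z \<Longrightarrow> h t = k t"
  then have "h t = k t" if "t \<in> B" for t
    using assms that by blast
  then show "(\<forall>t\<in>B. h t = a) \<longleftrightarrow> (\<forall>t\<in>B. k t = a)"
    by simp
qed

lemma spheroid_class_eqI:
  assumes "homotopic_with (\<lambda>h. \<forall>t\<in>cube_boundary k. h t = a) (cube k) Y f g"
  shows "spheroid_class k Y a f = spheroid_class k Y a g"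
  using assms homotopic_with_trans homotopic_with_symD unfolding spheroid_class_def by blast

lemma self_in_spheroid_class: "f \<in> spheroids k Y a \<Longrightarrow> f \<in> spheroid_class k Y a f"
  by (simp add: spheroid_class_def spheroids_def)

lemma homotopic_with_compose_spheroids:
  assumes "homotopic_with (\<lambda>h. \<forall>t\<in>cube_boundary k. h t = a) (cube k) X f g" "continuous_map X Y p"
  shows "homotopic_with (\<lambda>h. \<forall>t\<in>cube_boundary k. h t = p a) (cube k) Y (p \<circ> f) (p \<circ> g)"
  using assms by (rule homotopic_with_compose_continuous_map_left) simp

lemma homotopy_group_map_spheroid_class:
  assumes p: "continuous_map X Y p" and f: "f \<in> spheroids k X a"
  shows "homotopy_group_map k Y p a (spheroid_class k X a f) = spheroid_class k Y (p a) (p \<circ> f)"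
proof -
  have "spheroid_class k Y (p a) (p \<circ> g) = spheroid_class k Y (p a) (p \<circ> f)" if "g \<in> spheroid_class k X a f" for g
    using that unfolding spheroid_class_def[of k X]
    by (intro spheroid_class_eqI homotopic_with_compose_spheroids[OF _ p]) (simp add: homotopic_with_sym)
  then show ?thesis
    using self_in_spheroid_class[OF f] unfolding homotopy_group_map_def by blast
qed

text \<open>The rescaled first coordinate is clamped to the unit interval, so that each half of a join is
  a composite of maps that are continuous on the whole cylinder.\<close>

lemma continuous_map_rescale_cube:
  assumes "0 < k"
    and r: "continuous_map euclideanreal euclideanreal r" "\<And>s. r s \<in> {0..1}"
  shows "continuous_map (cube k) (cube k) (\<lambda>t. t(0 := r (t 0)))"
proof -
  have upd: "t(0 := r (t 0)) \<in> topspace (cube k)" if "t \<in> topspace (cube k)" for t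
    using that assms by (auto simp: topspace_cube PiE_iff extensional_def)
  have "continuous_map (cube k) (top_of_set {0..1}) (\<lambda>t. (t(0 := r (t 0))) i)" if "i < k" for i
  proof (rule continuous_map_into_subtopology)
    show "continuous_map (cube k) euclideanreal (\<lambda>t. (t(0 := r (t 0))) i)"
      using that assms continuous_map_compose[OF continuous_map_cube_coordinate[OF \<open>0 < k\<close>] r(1)]
      by (cases "i = 0") (auto simp: o_def continuous_map_cube_coordinate)
    show "(\<lambda>t. (t(0 := r (t 0))) i) \<in> topspace (cube k) \<rightarrow> {0..1}"
    proof (rule funcsetI)
      fix t assume "t \<in> topspace (cube k)"
      from upd[OF this, unfolded topspace_cube] show "(t(0 := r (t 0))) i \<in> {0..1}"
        by (rule PiE_mem) (use that in simp)
    qed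
  qed
  then have "continuous_map (cube k) (product_topology (\<lambda>_. top_of_set {0..1}) {..<k}) (\<lambda>t. t(0 := r (t 0)))"
    using upd unfolding continuous_map_componentwise topspace_cube PiE_def by blast
  then show ?thesis
    by (simp add: cube_def)
qed

lemma homotopic_with_spheroid_join:
  assumes "0 < k"
    and f: "homotopic_with (\<lambda>h. \<forall>t\<in>cube_boundary k. h t = a) (cube k) Y f f'"
    and g: "homotopic_with (\<lambda>h. \<forall>t\<in>cube_boundary k. h t = a) (cube k) Y g g'"
  shows "homotopic_with (\<lambda>h. \<forall>t\<in>cube_boundary k. h t = a) (cube k) Y (spheroid_join f g) (spheroid_join f' g')"
proof -
  let ?Z = "prod_topology (top_of_set {0..1::real}) (cube k)"
  obtain F where F: "continuous_map ?Z Y F" "\<And>t. t \<in> topspace (cube k) \<Longrightarrow> F (0, t) = f t"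
      "\<And>t. t \<in> topspace (cube k) \<Longrightarrow> F (1, t) = f' t"
      "\<And>s t. \<lbrakk>s \<in> {0..1}; t \<in> cube_boundary k\<rbrakk> \<Longrightarrow> F (s, t) = a"
    using f unfolding homotopic_rel_iff[OF cube_boundary_subset] by blast
  obtain G where G: "continuous_map ?Z Y G" "\<And>t. t \<in> topspace (cube k) \<Longrightarrow> G (0, t) = g t"
      "\<And>t. t \<in> topspace (cube k) \<Longrightarrow> G (1, t) = g' t"
      "\<And>s t. \<lbrakk>s \<in> {0..1}; t \<in> cube_boundary k\<rbrakk> \<Longrightarrow> G (s, t) = a"
    using g unfolding homotopic_rel_iff[OF cube_boundary_subset] by blast
  define l where "l s = max 0 (min 1 (2 * s))" for s :: real
  define r where "r s = max 0 (min 1 (2 * s - 1))" for s :: real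
  define L where "L t = t(0 := l (t 0))" for t :: "nat \<Rightarrow> real"
  define R where "R t = t(0 := r (t 0))" for t :: "nat \<Rightarrow> real"
  have L: "continuous_map (cube k) (cube k) L" and R: "continuous_map (cube k) (cube k) R"
    unfolding L_def R_def
    by (rule continuous_map_rescale_cube[OF \<open>0 < k\<close>];
        auto simp: l_def r_def intro!: continuous_map_real_max continuous_map_real_min continuous_intros)+
  have LR: "L t \<in> topspace (cube k)" "R t \<in> topspace (cube k)" if "t \<in> topspace (cube k)" for t
    using that L R by (auto simp: continuous_map_def)
  have t0: "0 \<le> t 0" "t 0 \<le> 1" if "t \<in> topspace (cube k)" for t
    using that \<open>0 < k\<close> by (auto simp: topspace_cube PiE_iff)
  have join: "spheroid_join p q t = (if t 0 \<le> 1/2 then p (L t) else q (R t))"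
    if "t \<in> topspace (cube k)" for p q :: "(nat \<Rightarrow> real) \<Rightarrow> 'a" and t
    using t0[OF that] by (auto simp: spheroid_join_def L_def R_def l_def r_def)
  \<comment> \<open>At \<open>t 0 = 1/2\<close> both halves meet the boundary, where \<open>F\<close> and \<open>G\<close> have the same value.\<close>
  have L_bd: "L t \<in> cube_boundary k"
    if "t \<in> cube_boundary k \<and> t 0 \<le> 1/2 \<or> t \<in> topspace (cube k) \<and> t 0 = 1/2" for t
  proof -
    have t: "t \<in> topspace (cube k)"
      using that cube_boundary_subset by blast
    from that consider "t 0 = 0" | "t 0 = 1/2" | i where "i < k" "i \<noteq> 0" "t i = 0 \<or> t i = 1"
      unfolding cube_boundary_def by (cases "t 0 = 0") force+
    then have "\<exists>i<k. L t i = 0 \<or> L t i = 1"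
    proof cases
      case 3
      then show ?thesis
        by (intro exI[of _ i]) (auto simp: L_def)
    qed (use \<open>0 < k\<close> in \<open>auto simp: L_def l_def\<close>)
    then show ?thesis
      using LR(1)[OF t] by (simp add: cube_boundary_def)
  qed
  have R_bd: "R t \<in> cube_boundary k"
    if "t \<in> cube_boundary k \<and> 1/2 < t 0 \<or> t \<in> topspace (cube k) \<and> t 0 = 1/2" for t
  proof -
    have t: "t \<in> topspace (cube k)"
      using that cube_boundary_subset by blast
    from that consider "t 0 = 1" | "t 0 = 1/2" | i where "i < k" "i \<noteq> 0" "t i = 0 \<or> t i = 1"
      unfolding cube_boundary_def by (cases "t 0 = 1") force+
    then have "\<exists>i<k. R t i = 0 \<or> R t i = 1"
    proof cases
      case 3
      then show ?thesis
        by (intro exI[of _ i]) (auto simp: R_def)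
    qed (use \<open>0 < k\<close> in \<open>auto simp: R_def r_def\<close>)
    then show ?thesis
      using LR(2)[OF t] by (simp add: cube_boundary_def)
  qed
  define H where "H z = (if snd z 0 \<le> 1/2 then F (fst z, L (snd z)) else G (fst z, R (snd z)))" for z
  have pair: "continuous_map ?Z ?Z (\<lambda>z. (fst z, P (snd z)))" if "continuous_map (cube k) (cube k) P" for P
    using continuous_map_compose[OF continuous_map_snd that]
    by (intro continuous_map_pairedI continuous_map_fst) (auto simp: o_def)
  have "continuous_map ?Z Y H"
    unfolding H_def
  proof (rule continuous_map_cases_le)
    show "continuous_map ?Z euclideanreal (\<lambda>z. snd z 0)"
      using continuous_map_compose[OF continuous_map_snd continuous_map_cube_coordinate[OF \<open>0 < k\<close>]]
      by (simp add: o_def)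
    show "continuous_map (subtopology ?Z {z \<in> topspace ?Z. snd z 0 \<le> 1/2}) Y (\<lambda>z. F (fst z, L (snd z)))"
      using continuous_map_compose[OF pair[OF L] F(1)] by (simp add: o_def continuous_map_from_subtopology)
    show "continuous_map (subtopology ?Z {z \<in> topspace ?Z. 1/2 \<le> snd z 0}) Y (\<lambda>z. G (fst z, R (snd z)))"
      using continuous_map_compose[OF pair[OF R] G(1)] by (simp add: o_def continuous_map_from_subtopology)
  qed (use F(4) G(4) L_bd R_bd in auto)
  moreover have "H (0, t) = spheroid_join f g t" "H (1, t) = spheroid_join f' g' t"
    if "t \<in> topspace (cube k)" for t
    using that LR F(2,3) G(2,3) by (auto simp: H_def join)
  moreover have "H (s, t) = a" if "s \<in> {0..1}" "t \<in> cube_boundary k" for s t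
    using that F(4) G(4) L_bd R_bd by (auto simp: H_def)
  ultimately show ?thesis
    unfolding homotopic_rel_iff[OF cube_boundary_subset] by blast
qed

lemma spheroid_join_in_spheroids:
  assumes "0 < k" "f \<in> spheroids k Y a" "g \<in> spheroids k Y a"
  shows "spheroid_join f g \<in> spheroids k Y a"
  using homotopic_with_spheroid_join[of k a Y f f g g] assms by (simp add: spheroids_def)

lemma mult_homotopy_group:
  assumes "0 < k" and f: "f \<in> spheroids k Y a" and g: "g \<in> spheroids k Y a"
  shows "spheroid_class k Y a f \<otimes>\<^bsub>homotopy_group k Y a\<^esub> spheroid_class k Y a g
    = spheroid_class k Y a (spheroid_join f g)"
proof -
  have "spheroid_class k Y a (spheroid_join f' g') = spheroid_class k Y a (spheroid_join f g)"
    if "f' \<in> spheroid_class k Y a f" "g' \<in> spheroid_class k Y a g" for f' g'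
    using that unfolding mem_Collect_eq spheroid_class_def[of k Y a f] spheroid_class_def[of k Y a g]
    by (intro spheroid_class_eqI[symmetric] homotopic_with_spheroid_join[OF \<open>0 < k\<close>])
  then have "(\<Union>f'\<in>spheroid_class k Y a f. \<Union>g'\<in>spheroid_class k Y a g. spheroid_class k Y a (spheroid_join f' g'))
      = (\<Union>f'\<in>spheroid_class k Y a f. \<Union>g'\<in>spheroid_class k Y a g. spheroid_class k Y a (spheroid_join f g))"
    by (intro SUP_cong refl)
  also have "\<dots> = spheroid_class k Y a (spheroid_join f g)"
  proof -
    have "spheroid_class k Y a f \<noteq> {}" "spheroid_class k Y a g \<noteq> {}"
      using self_in_spheroid_class[OF f] self_in_spheroid_class[OF g] by blast+
    then show ?thesis
      by simp
  qed
  finally show ?thesis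
    by (simp add: homotopy_group_def)
qed

lemma homotopy_group_map_hom:
  assumes p: "continuous_map X Y p" and "0 < k"
  shows "homotopy_group_map k Y p a \<in> hom (homotopy_group k X a) (homotopy_group k Y (p a))"
proof (rule homI)
  have car: "carrier (homotopy_group k Z b) = spheroid_class k Z b ` spheroids k Z b" for Z :: "'z topology" and b
    by (simp add: homotopy_group_def)
  have p_spheroid: "p \<circ> f \<in> spheroids k Y (p a)" if "f \<in> spheroids k X a" for f
    using that p by (auto simp: spheroids_def intro: continuous_map_compose)
  fix A assume "A \<in> carrier (homotopy_group k X a)"
  then obtain f where f: "f \<in> spheroids k X a" and A: "A = spheroid_class k X a f"
    by (auto simp: car)
  show "homotopy_group_map k Y p a A \<in> carrier (homotopy_group k Y (p a))"
    using p_spheroid[OF f] by (simp add: car A homotopy_group_map_spheroid_class[OF p f])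
  fix B assume "B \<in> carrier (homotopy_group k X a)"
  then obtain g where g: "g \<in> spheroids k X a" and B: "B = spheroid_class k X a g"
    by (auto simp: car)
  have "p \<circ> spheroid_join f g = spheroid_join (p \<circ> f) (p \<circ> g)"
    by (auto simp: spheroid_join_def)
  then show "homotopy_group_map k Y p a (A \<otimes>\<^bsub>homotopy_group k X a\<^esub> B)
      = homotopy_group_map k Y p a A \<otimes>\<^bsub>homotopy_group k Y (p a)\<^esub> homotopy_group_map k Y p a B"
    using spheroid_join_in_spheroids[OF \<open>0 < k\<close> f g]
    by (simp add: A B mult_homotopy_group \<open>0 < k\<close> f g p_spheroid homotopy_group_map_spheroid_class[OF p])
qed


section \<open>The canonical map on homotopy groups\<close>

text \<open>Surjectivity lifts a spheroid of the nerve relative to the boundary of the cube; injectivity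
  lifts a homotopy between two spheroids relative to the boundary of the cylinder.\<close>

lemma homotopy_group_map_canonical_bij:
  fixes X :: "'a metric"
  assumes wr: "weakly_regular_cover (separable_metric_spaces_dim_le n) (mtopology_of X) \<F>"
    and \<kappa>: "canonical_map (mtopology_of X) \<F> \<kappa>"
    and "k < n" "a \<in> mspace X"
  shows "bij_betw (homotopy_group_map k (metric_realization (nerve \<F>)) \<kappa> a)
    (carrier (homotopy_group k (mtopology_of X) a))
    (carrier (homotopy_group k (metric_realization (nerve \<F>)) (\<kappa> a)))"
proof -
  let ?N = "metric_realization (nerve \<F>)"
  let ?X = "mtopology_of X"
  let ?I = "top_of_set {0..1::real}"
  have cont: "continuous_map ?X ?N \<kappa>"
    by (rule continuous_map_canonical_map[OF \<kappa>])
  have car: "carrier (homotopy_group k Z b) = spheroid_class k Z b ` spheroids k Z b" for Z :: "'z topology" and b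
    by (simp add: homotopy_group_def)
  have \<kappa>_spheroid: "\<kappa> \<circ> f \<in> spheroids k ?N (\<kappa> a)" if "f \<in> spheroids k ?X a" for f
    using that cont by (auto simp: spheroids_def intro: continuous_map_compose)
  note map_eq = homotopy_group_map_spheroid_class[OF cont]
  have inj: "spheroid_class k ?X a f0 = spheroid_class k ?X a f1"
    if f: "f0 \<in> spheroids k ?X a" "f1 \<in> spheroids k ?X a"
      and eq: "spheroid_class k ?N (\<kappa> a) (\<kappa> \<circ> f0) = spheroid_class k ?N (\<kappa> a) (\<kappa> \<circ> f1)" for f0 f1
  proof -
    have "\<kappa> \<circ> f1 \<in> spheroid_class k ?N (\<kappa> a) (\<kappa> \<circ> f0)"
      unfolding eq by (rule self_in_spheroid_class[OF \<kappa>_spheroid[OF f(2)]])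
    then have "homotopic_with (\<lambda>h. \<forall>t\<in>cube_boundary k. h t = \<kappa> a) (cube k) ?N (\<kappa> \<circ> f0) (\<kappa> \<circ> f1)"
      by (simp add: spheroid_class_def)
    then obtain H where H: "continuous_map (prod_topology ?I (cube k)) ?N H"
        "\<And>t. t \<in> topspace (cube k) \<Longrightarrow> H (0, t) = \<kappa> (f0 t)" "\<And>t. t \<in> topspace (cube k) \<Longrightarrow> H (1, t) = \<kappa> (f1 t)"
        "\<And>s t. \<lbrakk>s \<in> {0..1}; t \<in> cube_boundary k\<rbrakk> \<Longrightarrow> H (s, t) = \<kappa> a"
      unfolding homotopic_rel_iff[OF cube_boundary_subset] by auto
    have f_cont: "continuous_map (cube k) ?X f0" "continuous_map (cube k) ?X f1"
      and f_bd: "\<And>t. t \<in> cube_boundary k \<Longrightarrow> f0 t = a" "\<And>t. t \<in> cube_boundary k \<Longrightarrow> f1 t = a"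
      using f by (auto simp: spheroids_def)
    define A where "A = {0, 1} \<times> topspace (cube k) \<union> {0..1::real} \<times> cube_boundary k"
    have A: "closedin (prod_topology ?I (cube k)) A"
      unfolding A_def by (intro closedin_Un)
        (auto simp: closedin_prod_Times_iff closedin_cube_boundary closedin_closed_subtopology)
    \<comment> \<open>On the lateral boundary both \<open>f0\<close> and \<open>f1\<close> are constantly \<open>a\<close>, so it does not matter that
      they are switched there at time \<open>1/2\<close>.\<close>
    define f where "f z = (if fst z \<le> 1/2 then f0 (snd z) else f1 (snd z))" for z :: "real \<times> (nat \<Rightarrow> real)"
    have f_cont': "continuous_map (subtopology (prod_topology ?I (cube k)) A) ?X f"
      unfolding f_def
    proof (rule continuous_map_cases_le)
      show "f0 (snd z) = f1 (snd z)" if "z \<in> topspace (subtopology (prod_topology ?I (cube k)) A)" "fst z = 1/2" for z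
        using that f_bd by (auto simp: A_def)
      show "continuous_map (subtopology (prod_topology ?I (cube k)) A) euclideanreal fst"
        by (intro continuous_map_from_subtopology continuous_map_cylinder_time)
    qed (use f_cont continuous_map_compose[OF continuous_map_snd] in
        \<open>auto simp: o_def intro!: continuous_map_from_subtopology\<close>)
    have Hf: "H z = \<kappa> (f z)" if "z \<in> A" for z
      using that H(2-4) f_bd cube_boundary_subset by (auto simp: A_def f_def)
    have compact: "compact_space (prod_topology ?I (cube k))"
      by (simp add: compact_space_prod_topology compact_space_interval compact_space_cube)
    have dim: "separable_metric_dim_le n (prod_topology ?I (cube k))"
      using separable_metric_dim_le_mono[OF separable_metric_dim_le_cylinder] \<open>k < n\<close> by simp
    obtain g where g: "continuous_map (prod_topology ?I (cube k)) ?X g" "\<And>z. z \<in> A \<Longrightarrow> g z = f z"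
      "homotopic_with (\<lambda>k. \<forall>z\<in>A. k z = H z) (prod_topology ?I (cube k)) ?N (\<kappa> \<circ> g) H"
      using relative_homotopy_lifting[OF wr \<kappa> compact dim A f_cont' H(1) Hf] by blast
    have "homotopic_with (\<lambda>h. \<forall>t\<in>cube_boundary k. h t = a) (cube k) ?X f0 f1"
      unfolding homotopic_rel_iff[OF cube_boundary_subset]
      using g f_bd by (intro exI[of _ g]) (auto simp: A_def f_def)
    then show ?thesis
      by (rule spheroid_class_eqI)
  qed
  have surj: "\<exists>g\<in>spheroids k ?X a. spheroid_class k ?N (\<kappa> a) (\<kappa> \<circ> g) = spheroid_class k ?N (\<kappa> a) h"
    if h: "h \<in> spheroids k ?N (\<kappa> a)" for h
  proof -
    have hc: "continuous_map (cube k) ?N h" and hb: "\<And>t. t \<in> cube_boundary k \<Longrightarrow> h t = \<kappa> a"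
      using h by (auto simp: spheroids_def)
    have const: "continuous_map (subtopology (cube k) (cube_boundary k)) ?X (\<lambda>_. a)"
      using \<open>a \<in> mspace X\<close> by simp
    have dim: "separable_metric_dim_le n (cube k)"
      using separable_metric_dim_le_mono[OF separable_metric_dim_le_cube] \<open>k < n\<close> by simp
    obtain g where g: "continuous_map (cube k) ?X g" "\<And>t. t \<in> cube_boundary k \<Longrightarrow> g t = a"
      "homotopic_with (\<lambda>k'. \<forall>t\<in>cube_boundary k. k' t = h t) (cube k) ?N (\<kappa> \<circ> g) h"
      using relative_homotopy_lifting[OF wr \<kappa> compact_space_cube dim closedin_cube_boundary const hc hb] by blast
    have "homotopic_with (\<lambda>k'. \<forall>t\<in>cube_boundary k. k' t = \<kappa> a) (cube k) ?N (\<kappa> \<circ> g) h"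
      using g(3) by (rule homotopic_with_mono) (simp add: hb)
    then show ?thesis
      using g(1,2) by (intro bexI[of _ g] spheroid_class_eqI) (auto simp: spheroids_def)
  qed
  show ?thesis
    unfolding bij_betw_def car
  proof
    show "inj_on (homotopy_group_map k ?N \<kappa> a) (spheroid_class k ?X a ` spheroids k ?X a)"
    proof (rule inj_onI, elim imageE)
      fix B C f0 f1
      assume "homotopy_group_map k ?N \<kappa> a B = homotopy_group_map k ?N \<kappa> a C"
        and "B = spheroid_class k ?X a f0" "C = spheroid_class k ?X a f1"
        and "f0 \<in> spheroids k ?X a" "f1 \<in> spheroids k ?X a"
      then show "B = C"
        using inj[of f0 f1] map_eq by simp
    qed
    show "homotopy_group_map k ?N \<kappa> a ` spheroid_class k ?X a ` spheroids k ?X a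
        = spheroid_class k ?N (\<kappa> a) ` spheroids k ?N (\<kappa> a)"
    proof (intro antisym subsetI)
      fix B assume "B \<in> spheroid_class k ?N (\<kappa> a) ` spheroids k ?N (\<kappa> a)"
      then obtain h where "h \<in> spheroids k ?N (\<kappa> a)" "B = spheroid_class k ?N (\<kappa> a) h"
        by blast
      then obtain g where "g \<in> spheroids k ?X a" "B = homotopy_group_map k ?N \<kappa> a (spheroid_class k ?X a g)"
        using surj[of h] map_eq by metis
      then show "B \<in> homotopy_group_map k ?N \<kappa> a ` spheroid_class k ?X a ` spheroids k ?X a"
        by blast
    qed (use map_eq \<kappa>_spheroid in auto)
  qed
qed

lemma path_components_map_path_component_of_set:
  assumes p: "continuous_map X Y p" and x: "x \<in> topspace X"
  shows "path_components_map Y p (path_component_of_set X x) = path_component_of_set Y (p x)"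
proof -
  have "path_component_of_set Y (p y) = path_component_of_set Y (p x)" if y: "y \<in> path_component_of_set X x" for y
  proof -
    obtain q where q: "pathin X q" "q 0 = x" "q 1 = y"
      using y by (auto simp: path_component_of_def)
    then have "pathin Y (p \<circ> q)"
      using p by (auto simp: pathin_def intro: continuous_map_compose)
    then have "path_component_of Y (p x) (p y)"
      using q by (auto simp: path_component_of_def)
    then show ?thesis
      by (simp add: path_component_of_equiv)
  qed
  moreover have "x \<in> path_component_of_set X x"
    using x by (simp add: path_component_of_refl)
  ultimately show ?thesis
    unfolding path_components_map_def by blast
qed

lemma path_components_map_canonical_bij:
  fixes X :: "'a metric"
  assumes wr: "weakly_regular_cover (separable_metric_spaces_dim_le n) (mtopology_of X) \<F>"
    and \<kappa>: "canonical_map (mtopology_of X) \<F> \<kappa>"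
    and "0 < n"
  shows "bij_betw (path_components_map (metric_realization (nerve \<F>)) \<kappa>)
    (path_components_of (mtopology_of X)) (path_components_of (metric_realization (nerve \<F>)))"
proof -
  let ?N = "metric_realization (nerve \<F>)"
  let ?X = "mtopology_of X"
  let ?I = "top_of_set {0..1::real}"
  have cont: "continuous_map ?X ?N \<kappa>"
    by (rule continuous_map_canonical_map[OF \<kappa>])
  note map_eq = path_components_map_path_component_of_set[OF cont]
  have dim: "separable_metric_dim_le n ?I"
    using separable_metric_dim_le_mono[OF separable_metric_dim_le_interval] \<open>0 < n\<close> by simp
  note lift = relative_homotopy_lifting[OF wr \<kappa> compact_space_interval dim]
  have inj: "path_component_of_set ?X x = path_component_of_set ?X y"
    if xy: "x \<in> topspace ?X" "y \<in> topspace ?X"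
      and eq: "path_component_of_set ?N (\<kappa> x) = path_component_of_set ?N (\<kappa> y)" for x y
  proof -
    have "\<kappa> y \<in> topspace ?N"
      using xy(2) cont by (auto simp: continuous_map_def)
    then have "path_component_of ?N (\<kappa> x) (\<kappa> y)"
      using eq path_component_of_refl[of ?N "\<kappa> y"] by blast
    then obtain h where h: "continuous_map ?I ?N h" "h 0 = \<kappa> x" "h 1 = \<kappa> y"
      by (auto simp: path_component_of_def pathin_def)
    have A: "closedin ?I {0, 1}"
      by (simp add: closedin_closed_subtopology)
    define f where "f s = (if s \<le> 1/2 then x else y)" for s :: real
    have f_cont: "continuous_map (subtopology ?I {0, 1}) ?X f"
      unfolding f_def
      by (rule continuous_map_cases_le) (use xy in \<open>auto intro!: continuous_map_from_subtopology\<close>)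
    have hf: "h s = \<kappa> (f s)" if "s \<in> {0, 1}" for s
      using that h(2,3) by (auto simp: f_def)
    obtain g where g: "continuous_map ?I ?X g" "\<And>s. s \<in> {0, 1} \<Longrightarrow> g s = f s"
      "homotopic_with (\<lambda>k. \<forall>s\<in>{0, 1}. k s = h s) ?I ?N (\<kappa> \<circ> g) h"
      using lift[OF A f_cont h(1) hf] by blast
    have "path_component_of ?X x y"
      using g by (auto simp: path_component_of_def pathin_def f_def intro!: exI[of _ g])
    then show ?thesis
      by (simp add: path_component_of_equiv)
  qed
  have surj: "\<exists>x\<in>topspace ?X. path_component_of_set ?N (\<kappa> x) = path_component_of_set ?N c"
    if c: "c \<in> topspace ?N" for c
  proof -
    have "continuous_map ?I ?N (\<lambda>_. c)"
      using c by simp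
    from lift[OF closedin_empty _ this, of undefined]
    obtain g where g: "continuous_map ?I ?X g" "homotopic_with (\<lambda>_. True) ?I ?N (\<kappa> \<circ> g) (\<lambda>_. c)"
      by auto
    obtain H where H: "continuous_map (prod_topology ?I ?I) ?N H" "\<And>s. H (0, s) = \<kappa> (g s)" "\<And>s. H (1, s) = c"
      using g(2) by (auto simp: homotopic_with_def)
    have "continuous_map ?I ?N (H \<circ> (\<lambda>s. (s, 0)))"
      by (rule continuous_map_compose[OF _ H(1)]) (intro continuous_map_pairedI, auto)
    then have "path_component_of ?N (\<kappa> (g 0)) c"
      using H(2,3) by (auto simp: path_component_of_def pathin_def intro!: exI[of _ "H \<circ> (\<lambda>s. (s, 0))"])
    moreover have "g 0 \<in> topspace ?X"
      using g(1) by (force simp: continuous_map_def)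
    ultimately show ?thesis
      by (intro bexI[of _ "g 0"]) (simp_all add: path_component_of_equiv)
  qed
  show ?thesis
    unfolding bij_betw_def path_components_of_def
  proof
    show "inj_on (path_components_map ?N \<kappa>) (path_component_of_set ?X ` topspace ?X)"
    proof (rule inj_onI, elim imageE)
      fix B C x y
      assume "path_components_map ?N \<kappa> B = path_components_map ?N \<kappa> C"
        and "B = path_component_of_set ?X x" "C = path_component_of_set ?X y"
        and "x \<in> topspace ?X" "y \<in> topspace ?X"
      then show "B = C"
        using inj[of x y] map_eq by simp
    qed
    show "path_components_map ?N \<kappa> ` path_component_of_set ?X ` topspace ?X
        = path_component_of_set ?N ` topspace ?N"
    proof (intro antisym subsetI)
      fix B assume "B \<in> path_component_of_set ?N ` topspace ?N"
      then obtain c where "c \<in> topspace ?N" "B = path_component_of_set ?N c"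
        by blast
      then obtain x where "x \<in> topspace ?X" "B = path_components_map ?N \<kappa> (path_component_of_set ?X x)"
        using surj[of c] map_eq by metis
      then show "B \<in> path_components_map ?N \<kappa> ` path_component_of_set ?X ` topspace ?X"
        by blast
    next
      fix B assume "B \<in> path_components_map ?N \<kappa> ` path_component_of_set ?X ` topspace ?X"
      then show "B \<in> path_component_of_set ?N ` topspace ?N"
        using map_eq cont unfolding continuous_map_def by blast
    qed
  qed
qed

theorem theorem3p4:
  fixes n :: nat and X :: "'a metric" and \<F> :: "'a set set" and \<kappa> :: "'a \<Rightarrow> 'a set \<Rightarrow> real"
  assumes "separable_space (mtopology_of X)"
    and "weakly_regular_cover (separable_metric_spaces_dim_le n) (mtopology_of X) \<F>"
    and "canonical_map (mtopology_of X) \<F> \<kappa>"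
  shows "induces_homotopy_isos_below n (mtopology_of X) (metric_realization (nerve \<F>)) \<kappa>"
proof -
  note cont = continuous_map_canonical_map[OF assms(3)]
  have "homotopy_group_map k (metric_realization (nerve \<F>)) \<kappa> a
      \<in> iso (homotopy_group k (mtopology_of X) a) (homotopy_group k (metric_realization (nerve \<F>)) (\<kappa> a))"
    if "k < n" "0 < k" "a \<in> topspace (mtopology_of X)" for k a
    using homotopy_group_map_hom[OF cont \<open>0 < k\<close>]
      homotopy_group_map_canonical_bij[OF assms(2,3) \<open>k < n\<close>] that(3)
    by (simp add: iso_def)
  then show ?thesis
    using cont path_components_map_canonical_bij[OF assms(2,3)]
    by (simp add: induces_homotopy_isos_below_def)
qed

end
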